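(* Assume (A.1) and (A.2) (stated in the context). Then, for any $h>0$, $\|R_h\|_{h\to h}\le1$. Moreover, there exist $h_0>0$ and a constant $q_0\in(0,1)$, independent of $h$, such that for all $h\le h_0$, $$\left\|\Pi^{(h)}_{T_{\mathcal B_h}(\widehat{\mathbf P}_h)}\circ R_h\right\|_{h\to h}\le q_0.$$
   Context: Mesh and discrete spaces. $\Omega\subset\mathbb R^2$ is a convex polygonal domain and $\{\mathcal T_h\}$ is a shape-regular, quasi-uniform family of triangulations of $\Omega$, with $h_K=\operatorname{diam}(K)$, $h=\max_{K\in\mathcal T_h}h_K$. "Independent of $h$" means uniform over the family. $\mathbb S^2$ is the space of symmetric $2\times2$ real matrices, $A:B=\operatorname{tr}(A^\top B)$, $|A|=\sqrt{A:A}$, and $\operatorname{cof}(P)=\det(P)P^{-T}$. Fix an integer $m\ge0$. $Z_h$ is the space of $v_h\in L^2(\Omega)$ with $v_h|_K\in\mathbb P_m(K)$ for all $K\in\mathcal T_h$ (no continuity across elements); $Z_h(\mathbb S^2)$ is its $\mathbb S^2$-valued analogue. For each $K$, $\{x_{K,j}\}_{j=1}^{N_m}$, $N_m=\dim\mathbb P_m(K)$, are local nodes obtained from a fixed unisolvent nodal configuration for $\mathbb P_m$ on the reference triangle by the affine map; nodes of different elements are treated as distinct and $v_h(x_{K,j}):=(v_h|_K)(x_{K,j})$. Positive weights $w_{K,j}$ satisfy $w_{K,j}\simeq h_K^2$ uniformly in $K,j,h$. Set $(v_h,z_h)_h=\sum_K\sum_j w_{K,j}v_h(x_{K,j})z_h(x_{K,j})$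 (with $:$ in place of the product for matrix fields) and $\|v_h\|_h^2=(v_h,v_h)_h$. For a linear $L:Z_h(\mathbb S^2)\to Z_h(\mathbb S^2)$, $\|L\|_{h\to h}=\sup_{\|\mathbf V_h\|_h\le1}\|L\mathbf V_h\|_h$. $\|\cdot\|_{L^2(\mathcal T_h)}$ is the broken $L^2$ norm, $\|v\|_{L^2(\mathcal T_h)}^2=\sum_K\|v\|_{L^2(K)}^2$. $I_h^Z:C^0(\overline\Omega)\to Z_h$ is the nodal interpolation operator, $(I_h^Zv)(x_{K,j})=v(x_{K,j})$, extended componentwise to matrix fields. (A.1) Exact solution. $f\in C^0(\overline\Omega)$ with $0<c_0\le f\le c_1<\infty$, and $u\in W^{3,\infty}(\Omega)\cap H^{m+3}(\Omega)$ is a convex solution of $\det D^2u=f$ in $\Omega$, $u=g$ on $\partial\Omega$ (with $g\in H^{3/2}(\partial\Omega)$), and there are $\nu_1\ge\nu_2>0$ with $\nu_2|\xi|^2\le\xi^TD^2u(x)\xi\le\nu_1|\xi|^2$ for all $\xi\in\mathbb R^2$, $x\in\Omega$; in particular $D^2u\in W^{1,\infty}(\Omega,\mathbb S^2)\cap H^{m+1}(\Omega,\mathbb S^2)$. Set $\widehat{\mathbf P}_h:=I_h^Z(D^2u)$. Tangent space. $T_{\mathcal B_h}(\widehat{\mathbf P}_h):=\{\mathbf W_h\in Z_h(\mathbb S^2):\ \operatorname{cof}(\widehat{\mathbf P}_h(x_{K,j})):\mathbf W_h(x_{K,j})=0\ \forall K\in\mathcal T_h,\ j=1,\dots,N_m\}$,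 and $\Pi^{(h)}_{T_{\mathcal B_h}(\widehat{\mathbf P}_h)}$ is the $(\cdot,\cdot)_h$-orthogonal projection of $Z_h(\mathbb S^2)$ onto it. Linear reconstruction. $X_h$ is a (finite-dimensional) scalar finite element space, $H_h:X_h\to Z_h(\mathbb S^2)$ a linear operator (discrete Hessian), $J_h:X_h\times X_h\to\mathbb R$ a symmetric positive semidefinite bilinear form, and $\sigma>0$ a fixed constant. Set $a_h(w_h,v_h):=(H_hw_h,H_hv_h)_h+\sigma J_h(w_h,v_h)$. Given $\mathbf P_h\in Z_h(\mathbb S^2)$, let $u_h=u_h(\mathbf P_h)\in X_h$ satisfy $a_h(u_h,v_h)=(\mathbf P_h,H_hv_h)_h$ for all $v_h\in X_h$, and set $R_h\mathbf P_h:=H_hu_h(\mathbf P_h)$; this is a well-defined linear map $R_h:Z_h(\mathbb S^2)\to Z_h(\mathbb S^2)$ (even if $u_h$ is not unique, $H_hu_h$ is). (A.2) There is $C>0$, independent of $h$, such that $\|H_hv_h\|_{L^2(\mathcal T_h)}\le\|\operatorname{tr}(H_hv_h)\|_{L^2(\mathcal T_h)}+C\,J_h(v_h,v_h)^{1/2}$ for all $v_h\in X_h$. *)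

theory Defs
  imports "HOL-Analysis.Analysis"
begin

section \<open>Matrices\<close>

text \<open>On \<^typ>\<open>real^2^2\<close> the library inner product \<open>A \<bullet> B\<close> is \<open>A : B = tr (A\<^sup>T B)\<close>, and hence
  the library norm is the Frobenius norm.\<close>

lemma inner_matrix_eq_trace:
  fixes A B :: "real^2^2"
  shows "A \<bullet> B = trace (transpose A ** B)"
  by (simp add: inner_vec_def trace_def transpose_def matrix_matrix_mult_def sum_2)

definition cof :: "real^2^2 \<Rightarrow> real^2^2" where
  "cof P = det P *\<^sub>R transpose (matrix_inv P)"

definition sym_matrix :: "real^2^2 \<Rightarrow> bool" where
  "sym_matrix A \<longleftrightarrow> transpose A = A"


section \<open>Sobolev regularity\<close>

text \<open>Derivatives are indexed by lists of coordinate directions instead of multi-indices;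
  \<open>[i, j]\<close> stands for \<open>\<partial>\<^sub>i \<partial>\<^sub>j\<close>.\<close>

definition pderiv_dir :: "2 \<Rightarrow> (real^2 \<Rightarrow> real) \<Rightarrow> real^2 \<Rightarrow> real" where
  "pderiv_dir i \<phi> = (\<lambda>x. frechet_derivative \<phi> (at x) (axis i 1))"

definition pderivs :: "2 list \<Rightarrow> (real^2 \<Rightarrow> real) \<Rightarrow> real^2 \<Rightarrow> real" where
  "pderivs l \<phi> = foldr pderiv_dir l \<phi>"

definition smooth :: "(real^2 \<Rightarrow> real) \<Rightarrow> bool" where
  "smooth \<phi> \<longleftrightarrow> (\<forall>l x. pderivs l \<phi> differentiable (at x))"

definition test_function :: "(real^2) set \<Rightarrow> (real^2 \<Rightarrow> real) \<Rightarrow> bool" where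
  "test_function \<Omega> \<phi> \<longleftrightarrow> smooth \<phi> \<and> compact (closure {x. \<phi> x \<noteq> 0}) \<and> closure {x. \<phi> x \<noteq> 0} \<subseteq> \<Omega>"

definition locally_integrable :: "(real^2) set \<Rightarrow> (real^2 \<Rightarrow> real) \<Rightarrow> bool" where
  "locally_integrable \<Omega> v \<longleftrightarrow> (\<forall>K. compact K \<and> K \<subseteq> \<Omega> \<longrightarrow> set_integrable lebesgue K v)"

definition weak_deriv :: "(real^2) set \<Rightarrow> 2 list \<Rightarrow> (real^2 \<Rightarrow> real) \<Rightarrow> (real^2 \<Rightarrow> real) \<Rightarrow> bool" where
  "weak_deriv \<Omega> l u v \<longleftrightarrow> locally_integrable \<Omega> u \<and> locally_integrable \<Omega> v \<and>
     (\<forall>\<phi>. test_function \<Omega> \<phi> \<longrightarrow>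
        (LINT x:\<Omega>|lebesgue. u x * pderivs l \<phi> x) = (-1) ^ length l * (LINT x:\<Omega>|lebesgue. v x * \<phi> x))"

definition in_L2 :: "(real^2) set \<Rightarrow> (real^2 \<Rightarrow> real) \<Rightarrow> bool" where
  "in_L2 \<Omega> v \<longleftrightarrow> set_borel_measurable lebesgue \<Omega> v \<and> set_integrable lebesgue \<Omega> (\<lambda>x. (v x)\<^sup>2)"

definition in_Linf :: "(real^2) set \<Rightarrow> (real^2 \<Rightarrow> real) \<Rightarrow> bool" where
  "in_Linf \<Omega> v \<longleftrightarrow> set_borel_measurable lebesgue \<Omega> v \<and>
     (\<exists>B. AE x in lebesgue. x \<in> \<Omega> \<longrightarrow> \<bar>v x\<bar> \<le> B)"

definition sobolev_H :: "nat \<Rightarrow> (real^2) set \<Rightarrow> (real^2 \<Rightarrow> real) \<Rightarrow> bool" where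
  "sobolev_H k \<Omega> u \<longleftrightarrow> (\<forall>l. length l \<le> k \<longrightarrow> (\<exists>v. weak_deriv \<Omega> l u v \<and> in_L2 \<Omega> v))"

definition sobolev_Winf :: "nat \<Rightarrow> (real^2) set \<Rightarrow> (real^2 \<Rightarrow> real) \<Rightarrow> bool" where
  "sobolev_Winf k \<Omega> u \<longleftrightarrow> (\<forall>l. length l \<le> k \<longrightarrow> (\<exists>v. weak_deriv \<Omega> l u v \<and> in_Linf \<Omega> v))"

text \<open>\<open>H\<^bsup>3/2\<^esup>(\<partial>\<Omega>)\<close> is the trace space of \<open>H\<^sup>2(\<Omega>)\<close>. In two dimensions every element of \<open>H\<^sup>2(\<Omega>)\<close>
  has a representative continuous up to the boundary, whose restriction is the trace.\<close>

definition boundary_H32 :: "(real^2) set \<Rightarrow> (real^2 \<Rightarrow> real) \<Rightarrow> bool" where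
  "boundary_H32 \<Omega> g \<longleftrightarrow>
     (\<exists>v. continuous_on (closure \<Omega>) v \<and> sobolev_H 2 \<Omega> v \<and> (\<forall>x\<in>frontier \<Omega>. v x = g x))"

definition polygonal_convex_domain :: "(real^2) set \<Rightarrow> bool" where
  "polygonal_convex_domain \<Omega> \<longleftrightarrow> open \<Omega> \<and> \<Omega> \<noteq> {} \<and> convex \<Omega> \<and> polytope (closure \<Omega>)"

text \<open>Assumption (A.1). The function \<open>u\<close> and its Hessian are represented by their representatives
  continuous on the closed domain, which exist since \<open>u \<in> W\<^bsup>3,\<infinity>\<^esup>(\<Omega>)\<close>; \<open>D2u\<close> is this
  representative of the Hessian, and it is what the nodal interpolation is applied to.\<close>

definition exact_solution ::
  "nat \<Rightarrow> (real^2) set \<Rightarrow> (real^2 \<Rightarrow> real) \<Rightarrow> (real^2 \<Rightarrow> real) \<Rightarrow> (real^2 \<Rightarrow> real) \<Rightarrow> (real^2 \<Rightarrow> real^2^2) \<Rightarrow> bool"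
  where
  "exact_solution m \<Omega> f g u D2u \<longleftrightarrow>
     continuous_on (closure \<Omega>) f \<and>
     (\<exists>c0 c1. 0 < c0 \<and> (\<forall>x\<in>closure \<Omega>. c0 \<le> f x \<and> f x \<le> c1)) \<and>
     boundary_H32 \<Omega> g \<and>
     sobolev_Winf 3 \<Omega> u \<and> sobolev_H (m + 3) \<Omega> u \<and>
     continuous_on (closure \<Omega>) u \<and> convex_on \<Omega> u \<and>
     continuous_on (closure \<Omega>) D2u \<and> (\<forall>i j. weak_deriv \<Omega> [i, j] u (\<lambda>x. D2u x $ i $ j)) \<and>
     (\<forall>x\<in>\<Omega>. det (D2u x) = f x) \<and>
     (\<forall>x\<in>frontier \<Omega>. u x = g x) \<and>
     (\<exists>\<nu>1 \<nu>2. \<nu>1 \<ge> \<nu>2 \<and> \<nu>2 > 0 \<and>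
        (\<forall>x\<in>\<Omega>. \<forall>\<xi>. \<nu>2 * (norm \<xi>)\<^sup>2 \<le> \<xi> \<bullet> (D2u x *v \<xi>) \<and> \<xi> \<bullet> (D2u x *v \<xi>) \<le> \<nu>1 * (norm \<xi>)\<^sup>2))"


section \<open>Polynomials and reference nodes\<close>

definition monomials :: "nat \<Rightarrow> (nat \<times> nat) set" where
  "monomials m = {(a, b). a + b \<le> m}"

definition polys :: "nat \<Rightarrow> (real^2 \<Rightarrow> real) set" where
  "polys m = {p. \<exists>c. p = (\<lambda>x. \<Sum>(a, b)\<in>monomials m. c a b * (x $ 1) ^ a * (x $ 2) ^ b)}"

definition dim_polys :: "nat \<Rightarrow> nat" where
  "dim_polys m = card (monomials m)"

definition ref_triangle :: "(real^2) set" where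
  "ref_triangle = convex hull {0, axis 1 1, axis 2 1}"

definition unisolvent_nodes :: "nat \<Rightarrow> (nat \<Rightarrow> real^2) \<Rightarrow> bool" where
  "unisolvent_nodes m xr \<longleftrightarrow>
     (\<forall>j\<in>{1..dim_polys m}. xr j \<in> ref_triangle) \<and>
     (\<forall>y. \<exists>!p. p \<in> polys m \<and> (\<forall>j\<in>{1..dim_polys m}. p (xr j) = y j))"


section \<open>Meshes\<close>

text \<open>A mesh comes with the affine parametrization \<open>ref_map M K\<close> of each triangle by the reference
  triangle (this fixes an ordering of the vertices) and the quadrature weights.\<close>

record mesh =
  elements :: "(real^2) set set"
  ref_map :: "(real^2) set \<Rightarrow> real^2 \<Rightarrow> real^2"
  weight :: "(real^2) set \<Rightarrow> nat \<Rightarrow> real"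

definition mesh_on :: "(real^2) set \<Rightarrow> mesh \<Rightarrow> bool" where
  "mesh_on \<Omega> M \<longleftrightarrow>
     triangulation (elements M) \<and> (\<forall>K\<in>elements M. 2 simplex K) \<and> \<Union>(elements M) = closure \<Omega> \<and>
     (\<forall>K\<in>elements M. (\<exists>A b. \<forall>x. ref_map M K x = A *v x + b) \<and> ref_map M K ` ref_triangle = K)"

definition mesh_size :: "mesh \<Rightarrow> real" where
  "mesh_size M = Max (diameter ` elements M)"

definition inball_diameter :: "(real^2) set \<Rightarrow> real" where
  "inball_diameter K = Sup {2 * r |r. r \<ge> 0 \<and> (\<exists>c. cball c r \<subseteq> K)}"

definition shape_regular :: "'i set \<Rightarrow> ('i \<Rightarrow> mesh) \<Rightarrow> bool" where
  "shape_regular I M \<longleftrightarrow>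
     (\<exists>\<kappa>>0. \<forall>i\<in>I. \<forall>K\<in>elements (M i). diameter K \<le> \<kappa> * inball_diameter K)"

definition quasi_uniform :: "'i set \<Rightarrow> ('i \<Rightarrow> mesh) \<Rightarrow> bool" where
  "quasi_uniform I M \<longleftrightarrow>
     (\<exists>\<kappa>>0. \<forall>i\<in>I. \<forall>K\<in>elements (M i). mesh_size (M i) \<le> \<kappa> * diameter K)"

definition weights_ok :: "nat \<Rightarrow> 'i set \<Rightarrow> ('i \<Rightarrow> mesh) \<Rightarrow> bool" where
  "weights_ok m I M \<longleftrightarrow>
     (\<exists>c>0. \<exists>C>0. \<forall>i\<in>I. \<forall>K\<in>elements (M i). \<forall>j\<in>{1..dim_polys m}.
        c * (diameter K)\<^sup>2 \<le> weight (M i) K j \<and> weight (M i) K j \<le> C * (diameter K)\<^sup>2)"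


section \<open>Discontinuous piecewise polynomials\<close>

text \<open>A function on \<open>\<Omega>\<close> that is polynomial on each triangle is encoded by the family
  \<open>K \<mapsto> V K\<close> of its polynomial pieces (each extended to the plane, and the family extended by zero
  to sets \<open>K\<close> that are not elements), so that \<open>V K x\<close> is \<open>(V|\<^sub>K)(x)\<close>.\<close>

type_synonym 'b broken = "(real^2) set \<Rightarrow> real^2 \<Rightarrow> 'b"

definition Zh :: "nat \<Rightarrow> mesh \<Rightarrow> real broken set" where
  "Zh m M = {v. (\<forall>K\<in>elements M. v K \<in> polys m) \<and> (\<forall>K. K \<notin> elements M \<longrightarrow> v K = (\<lambda>x. 0))}"

definition Zh_sym :: "nat \<Rightarrow> mesh \<Rightarrow> (real^2^2) broken set" where
  "Zh_sym m M = {V. (\<forall>K x. sym_matrix (V K x)) \<and> (\<forall>a b. (\<lambda>K x. V K x $ a $ b) \<in> Zh m M)}"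

definition node :: "(nat \<Rightarrow> real^2) \<Rightarrow> mesh \<Rightarrow> (real^2) set \<Rightarrow> nat \<Rightarrow> real^2" where
  "node xr M K j = ref_map M K (xr j)"

definition inner_h :: "nat \<Rightarrow> (nat \<Rightarrow> real^2) \<Rightarrow> mesh \<Rightarrow> 'b::real_inner broken \<Rightarrow> 'b broken \<Rightarrow> real" where
  "inner_h m xr M V W =
     (\<Sum>K\<in>elements M. \<Sum>j\<in>{1..dim_polys m}.
        weight M K j * (V K (node xr M K j) \<bullet> W K (node xr M K j)))"

definition norm_h :: "nat \<Rightarrow> (nat \<Rightarrow> real^2) \<Rightarrow> mesh \<Rightarrow> 'b::real_inner broken \<Rightarrow> real" where
  "norm_h m xr M V = sqrt (inner_h m xr M V V)"

definition L2_broken :: "mesh \<Rightarrow> 'b::real_inner broken \<Rightarrow> real" where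
  "L2_broken M V = sqrt (\<Sum>K\<in>elements M. LINT x:K|lebesgue. (norm (V K x))\<^sup>2)"

text \<open>The supremum is taken in the extended reals, so that an upper bound for it entails boundedness.\<close>

definition opnorm_h ::
  "nat \<Rightarrow> (nat \<Rightarrow> real^2) \<Rightarrow> mesh \<Rightarrow> ((real^2^2) broken \<Rightarrow> (real^2^2) broken) \<Rightarrow> ereal" where
  "opnorm_h m xr M L =
     (SUP V\<in>{V \<in> Zh_sym m M. norm_h m xr M V \<le> 1}. ereal (norm_h m xr M (L V)))"

definition interp :: "nat \<Rightarrow> (nat \<Rightarrow> real^2) \<Rightarrow> mesh \<Rightarrow> (real^2 \<Rightarrow> real) \<Rightarrow> real broken" where
  "interp m xr M v =
     (THE vh. vh \<in> Zh m M \<and>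
        (\<forall>K\<in>elements M. \<forall>j\<in>{1..dim_polys m}. vh K (node xr M K j) = v (node xr M K j)))"

definition interp_matrix ::
  "nat \<Rightarrow> (nat \<Rightarrow> real^2) \<Rightarrow> mesh \<Rightarrow> (real^2 \<Rightarrow> real^2^2) \<Rightarrow> (real^2^2) broken" where
  "interp_matrix m xr M G = (\<lambda>K x. \<chi> a b. interp m xr M (\<lambda>y. G y $ a $ b) K x)"

definition tangent_space ::
  "nat \<Rightarrow> (nat \<Rightarrow> real^2) \<Rightarrow> mesh \<Rightarrow> (real^2^2) broken \<Rightarrow> (real^2^2) broken set" where
  "tangent_space m xr M P =
     {W \<in> Zh_sym m M. \<forall>K\<in>elements M. \<forall>j\<in>{1..dim_polys m}.
        cof (P K (node xr M K j)) \<bullet> W K (node xr M K j) = 0}"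

definition orth_proj ::
  "nat \<Rightarrow> (nat \<Rightarrow> real^2) \<Rightarrow> mesh \<Rightarrow> (real^2^2) broken set \<Rightarrow> (real^2^2) broken \<Rightarrow> (real^2^2) broken" where
  "orth_proj m xr M S W =
     (THE V. V \<in> S \<and> (\<forall>U\<in>S. inner_h m xr M (\<lambda>K x. W K x - V K x) U = 0))"


section \<open>Linear reconstruction\<close>

definition finite_dim_subspace :: "'x::real_vector set \<Rightarrow> bool" where
  "finite_dim_subspace X \<longleftrightarrow> (\<exists>B. finite B \<and> X = span B)"

definition discrete_hessian ::
  "nat \<Rightarrow> mesh \<Rightarrow> 'x::real_vector set \<Rightarrow> ('x \<Rightarrow> (real^2^2) broken) \<Rightarrow> bool" where
  "discrete_hessian m M X H \<longleftrightarrow>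
     (\<forall>v\<in>X. H v \<in> Zh_sym m M) \<and>
     (\<forall>v\<in>X. \<forall>w\<in>X. H (v + w) = (\<lambda>K x. H v K x + H w K x)) \<and>
     (\<forall>c. \<forall>v\<in>X. H (c *\<^sub>R v) = (\<lambda>K x. c *\<^sub>R H v K x))"

definition sym_psd_form :: "'x::real_vector set \<Rightarrow> ('x \<Rightarrow> 'x \<Rightarrow> real) \<Rightarrow> bool" where
  "sym_psd_form X J \<longleftrightarrow>
     (\<forall>v\<in>X. \<forall>w\<in>X. J v w = J w v) \<and>
     (\<forall>u\<in>X. \<forall>v\<in>X. \<forall>w\<in>X. J (u + v) w = J u w + J v w) \<and>
     (\<forall>c. \<forall>v\<in>X. \<forall>w\<in>X. J (c *\<^sub>R v) w = c * J v w) \<and>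
     (\<forall>v\<in>X. 0 \<le> J v v)"

definition recon_form ::
  "nat \<Rightarrow> (nat \<Rightarrow> real^2) \<Rightarrow> mesh \<Rightarrow> ('x \<Rightarrow> (real^2^2) broken) \<Rightarrow> ('x \<Rightarrow> 'x \<Rightarrow> real) \<Rightarrow> real \<Rightarrow>
   'x \<Rightarrow> 'x \<Rightarrow> real" where
  "recon_form m xr M H J \<sigma> w v = inner_h m xr M (H w) (H v) + \<sigma> * J w v"

text \<open>The solution \<open>u\<^sub>h\<close> always exists but need not be unique; the choice does not matter because
  its image under \<open>H\<close> is unique.\<close>

definition recon_solution ::
  "nat \<Rightarrow> (nat \<Rightarrow> real^2) \<Rightarrow> mesh \<Rightarrow> 'x set \<Rightarrow> ('x \<Rightarrow> (real^2^2) broken) \<Rightarrow> ('x \<Rightarrow> 'x \<Rightarrow> real) \<Rightarrow> real \<Rightarrow>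
   (real^2^2) broken \<Rightarrow> 'x" where
  "recon_solution m xr M X H J \<sigma> P =
     (SOME uh. uh \<in> X \<and> (\<forall>v\<in>X. recon_form m xr M H J \<sigma> uh v = inner_h m xr M P (H v)))"

definition recon ::
  "nat \<Rightarrow> (nat \<Rightarrow> real^2) \<Rightarrow> mesh \<Rightarrow> 'x set \<Rightarrow> ('x \<Rightarrow> (real^2^2) broken) \<Rightarrow> ('x \<Rightarrow> 'x \<Rightarrow> real) \<Rightarrow> real \<Rightarrow>
   (real^2^2) broken \<Rightarrow> (real^2^2) broken" where
  "recon m xr M X H J \<sigma> P = H (recon_solution m xr M X H J \<sigma> P)"

text \<open>Assumption (A.2).\<close>

definition trace_control ::
  "'i set \<Rightarrow> ('i \<Rightarrow> mesh) \<Rightarrow> ('i \<Rightarrow> 'x set) \<Rightarrow> ('i \<Rightarrow> 'x \<Rightarrow> (real^2^2) broken) \<Rightarrow>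
   ('i \<Rightarrow> 'x \<Rightarrow> 'x \<Rightarrow> real) \<Rightarrow> bool" where
  "trace_control I M X H J \<longleftrightarrow>
     (\<exists>C>0. \<forall>i\<in>I. \<forall>v\<in>X i.
        L2_broken (M i) (H i v) \<le> L2_broken (M i) (\<lambda>K x. trace (H i v K x)) + C * sqrt (J i v v))"

end

theory Submission
  imports Defs
begin

text \<open>The reconstruction is the orthogonal projection of \<open>P\<close> onto the discrete Hessians, damped by the
stabilization: testing the equation with \<open>u\<^sub>h\<close> itself gives, for \<open>W = H\<^sub>h u\<^sub>h\<close> and \<open>a = \<parallel>W\<parallel>\<^sub>h\<close>,
the energy identity \<open>a\<^sup>2 + \<sigma> J(u\<^sub>h, u\<^sub>h) = (P, W)\<^sub>h \<le> \<parallel>P\<parallel>\<^sub>h a\<close> (\<open>recon_energy\<close>). This is the bound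
\<open>a \<le> 1\<close> for \<open>\<parallel>P\<parallel>\<^sub>h \<le> 1\<close>, and it says more: \<open>\<sigma> J \<le> a - a\<^sup>2\<close>, so \<open>a\<close> can be close to \<open>1\<close>
only if the stabilization is small.

The projection onto the tangent space acts node by node: it removes from \<open>W(x)\<close> the component along
\<open>A(x)\<close>, the cofactor matrix of the exact Hessian, so it loses exactly
\<open>d\<^sup>2 = \<Sum> w (A : W)\<^sup>2 / |A|\<^sup>2\<close> (\<open>norm_orth_proj_tangent\<close>). A uniform contraction therefore follows
once \<open>a\<^sup>2 \<le> C (d\<^sup>2 + J)\<close> with \<open>C\<close> independent of \<open>h\<close> (\<open>hessian_coercive\<close>): a nonzero discrete Hessian with no
stabilization energy cannot be tangent. With \<open>b\<^sup>2 = a\<^sup>2 - d\<^sup>2\<close> the two estimates give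
\<open>b\<^sup>2 \<le> D / (1 + D)\<close> where \<open>D = C + C / \<sigma>\<close> (\<open>contraction_from_energy\<close>).

The coercivity estimate is the Cordes argument for nondivergence operators. In two dimensions a
uniformly elliptic \<open>A\<close> satisfies \<open>|I - \<gamma> A|\<^sup>2 \<le> 1 - \<epsilon>\<close> for \<open>\<gamma> = tr A / |A|\<^sup>2\<close>, whence
\<open>tr W = \<gamma> (A : W) + (I - \<gamma> A) : W\<close> is controlled by \<open>A : W\<close> up to strictly less than \<open>|W|\<close>
(\<open>cordes_inequality\<close>); inserted in the assumed bound of \<open>\<parallel>W\<parallel>\<close> by \<open>\<parallel>tr W\<parallel>\<close> and \<open>J\<close>, the last term
is absorbed. The assumed bound lives in \<open>L\<^sup>2\<close> whereas the tangent condition is nodal. To pass between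
them \<open>A\<close> is frozen at one point of each triangle, so that \<open>A : W\<close> becomes a polynomial, for
which the nodal and the \<open>L\<^sup>2\<close> norm are equivalent uniformly in the family
(\<open>uniform_nodal_equivalence\<close>); the price is the oscillation of \<open>A\<close> on a triangle, which is small for
small \<open>h\<close> by uniform continuity. This is the only place where \<open>h \<le> h\<^sub>0\<close> enters.\<close>

section \<open>Consistent semidefinite systems\<close>

lemma quadratic_nonneg_imp_linear_zero:
  fixes p q :: real
  assumes "\<And>t. 0 \<le> 2 * t * p + q"
  shows "p = 0"
proof (rule ccontr)
  assume "p \<noteq> 0"
  then show False
    using assms[of "- (q + 1) / (2 * p)"] by (simp add: field_simps)
qed

text \<open>Existence of \<open>u\<^sub>h\<close>, and later of polynomials that represent point evaluation in \<open>L\<^sup>2\<close>, are both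
instances of solving a symmetric positive semidefinite system whose right-hand side annihilates the
kernel. The proof is Gaussian elimination: \<open>d\<close> expresses the last basis vector \<open>b\<close> through the others
as far as the form can see, and \<open>e = b - d\<close> is orthogonal to them. Either the pivot \<open>s = Q(e)\<close> is
positive and the solution is corrected along \<open>e\<close>, or \<open>e\<close> is in the kernel and the right-hand side is
already consistent.\<close>

lemma semidefinite_system_solvable:
  fixes G :: "'b \<Rightarrow> 'b \<Rightarrow> real"
  assumes "finite B"
    and "\<And>x y. x \<in> B \<Longrightarrow> y \<in> B \<Longrightarrow> G x y = G y x"
    and "\<And>c. 0 \<le> (\<Sum>x\<in>B. \<Sum>y\<in>B. c x * c y * G x y)"
    and "\<And>c. (\<Sum>x\<in>B. \<Sum>y\<in>B. c x * c y * G x y) = 0 \<Longrightarrow> (\<Sum>x\<in>B. c x * l x) = 0"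
  shows "\<exists>c. \<forall>x\<in>B. (\<Sum>y\<in>B. G x y * c y) = l x"
  using assms
proof (induction B arbitrary: l rule: finite_induct)
  case empty
  then show ?case by simp
next
  case (insert b B)
  have sym: "G x y = G y x" if "x \<in> insert b B" "y \<in> insert b B" for x y
    using insert.prems(1) that by blast
  define Q where "Q c = (\<Sum>x\<in>B. \<Sum>y\<in>B. c x * c y * G x y)" for c
  have upd: "(\<Sum>x\<in>B. f ((c(b := t)) x) x) = (\<Sum>x\<in>B. f (c x) x)" for f :: "real \<Rightarrow> 'b \<Rightarrow> real" and c t
    by (rule sum.cong) (use insert.hyps in auto)
  have upd2: "Q (c(b := t)) = Q c" for c t
    unfolding Q_def
    by (intro sum.cong refl) (use insert.hyps in auto)
  have Qins: "(\<Sum>x\<in>insert b B. \<Sum>y\<in>insert b B. c x * c y * G x y) =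
      Q c + 2 * c b * (\<Sum>x\<in>B. c x * G x b) + c b * c b * G b b" for c
  proof -
    have "(\<Sum>y\<in>B. c b * c y * G b y) = c b * (\<Sum>x\<in>B. c x * G x b)"
      by (simp add: sum_distrib_left mult.assoc sym cong: sum.cong)
    moreover have "(\<Sum>x\<in>B. c x * c b * G x b) = c b * (\<Sum>x\<in>B. c x * G x b)"
      by (simp add: sum_distrib_left ac_simps)
    ultimately show ?thesis
      using insert.hyps by (simp add: Q_def sum.distrib algebra_simps)
  qed
  have Qnn: "0 \<le> Q c" for c
    using insert.prems(2)[of "c(b := 0)"] upd2[of c 0] by (simp only: Qins) simp
  \<comment> \<open>Semidefiniteness on \<open>insert b B\<close> forces the mixed entries to annihilate the kernel on \<open>B\<close>.\<close>
  have Qlin: "(\<Sum>x\<in>B. c x * G x b) = 0" if "Q c = 0" for c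
  proof (rule quadratic_nonneg_imp_linear_zero[where q = "G b b"])
    fix t :: real
    have Qs: "Q (\<lambda>x. t * c x) = 0"
    proof -
      have "Q (\<lambda>x. t * c x) = t * t * Q c"
        by (simp add: Q_def sum_distrib_left ac_simps)
      with that show ?thesis by simp
    qed
    define d where "d = (\<lambda>x. t * c x)(b := 1)"
    have "Q d = 0" and "d b = 1"
      unfolding d_def upd2 using Qs by simp_all
    moreover have "(\<Sum>x\<in>B. d x * G x b) = t * (\<Sum>x\<in>B. c x * G x b)"
      unfolding d_def upd[of "\<lambda>r x. r * G x b"] by (simp add: sum_distrib_left mult.assoc)
    ultimately show "0 \<le> 2 * t * (\<Sum>x\<in>B. c x * G x b) + G b b"
      using insert.prems(2)[of d, unfolded Qins] by (simp add: mult.assoc)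
  qed
  have lB: "(\<Sum>x\<in>B. c x * l x) = 0" if "Q c = 0" for c
  proof -
    have "(\<Sum>x\<in>insert b B. (c(b := 0)) x * l x) = 0"
      by (rule insert.prems(3)) (simp only: Qins, simp add: upd2 that del: fun_upd_apply, simp)
    then show ?thesis
      using insert.hyps upd[of "\<lambda>r x. r * l x" c 0] by simp
  qed
  have solveB: "\<exists>c. \<forall>x\<in>B. (\<Sum>y\<in>B. G x y * c y) = k x"
    if "\<And>c. Q c = 0 \<Longrightarrow> (\<Sum>x\<in>B. c x * k x) = 0" for k
    by (rule insert.IH) (use sym Qnn that in \<open>auto simp: Q_def\<close>)
  obtain d where d: "\<And>x. x \<in> B \<Longrightarrow> (\<Sum>y\<in>B. G x y * d y) = G x b"
    using solveB[of "\<lambda>x. G x b"] Qlin by blast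
  obtain c0 where c0: "\<And>x. x \<in> B \<Longrightarrow> (\<Sum>y\<in>B. G x y * c0 y) = l x"
    using solveB[of l] lB by blast
  define s where "s = G b b - (\<Sum>y\<in>B. d y * G y b)"
  define r where "r = l b - (\<Sum>y\<in>B. d y * l y)"
  define e where "e = (\<lambda>x. - d x)(b := 1)"
  have Qd: "Q d = (\<Sum>y\<in>B. d y * G y b)"
  proof -
    have "Q d = (\<Sum>x\<in>B. d x * (\<Sum>y\<in>B. G x y * d y))"
      by (simp add: Q_def sum_distrib_left ac_simps)
    also have "\<dots> = (\<Sum>y\<in>B. d y * G y b)"
      by (rule sum.cong) (simp_all add: d)
    finally show ?thesis .
  qed
  have Qe: "(\<Sum>x\<in>insert b B. \<Sum>y\<in>insert b B. e x * e y * G x y) = s"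
  proof -
    have "Q e = Q d"
      unfolding e_def upd2 by (simp add: Q_def)
    moreover have "(\<Sum>x\<in>B. e x * G x b) = - (\<Sum>x\<in>B. d x * G x b)"
      unfolding e_def upd[of "\<lambda>r x. r * G x b"] by (simp add: sum_negf)
    moreover have "e b = 1" by (simp add: e_def)
    ultimately show ?thesis
      by (simp only: Qins) (simp add: s_def Qd)
  qed
  have le: "(\<Sum>x\<in>insert b B. e x * l x) = r"
    using insert.hyps unfolding r_def e_def
    by (simp add: upd[of "\<lambda>r x. r * l x"] sum_negf del: fun_upd_apply) simp
  have r0: "r = 0" if "s = 0"
    using insert.prems(3)[of e] Qe le that by simp
  \<comment> \<open>For \<open>s = 0\<close> this is \<open>0\<close> by the convention for division, which is the right value since then \<open>r = 0\<close>.\<close>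
  define t where "t = r / s"
  have ts: "t * s = r"
    using r0 by (cases "s = 0") (auto simp: t_def)
  define c where "c = (\<lambda>x. c0 x - t * d x)(b := t)"
  have c0b: "(\<Sum>y\<in>B. G b y * c0 y) = (\<Sum>x\<in>B. d x * l x)"
  proof -
    have "(\<Sum>x\<in>B. d x * l x) = (\<Sum>x\<in>B. \<Sum>y\<in>B. d x * G x y * c0 y)"
      by (simp add: c0[symmetric] sum_distrib_left mult.assoc)
    also have "\<dots> = (\<Sum>y\<in>B. \<Sum>x\<in>B. d x * G x y * c0 y)"
      by (rule sum.swap)
    also have "\<dots> = (\<Sum>y\<in>B. (\<Sum>x\<in>B. G y x * d x) * c0 y)"
      by (simp add: sum_distrib_left sym ac_simps cong: sum.cong)
    also have "\<dots> = (\<Sum>y\<in>B. G b y * c0 y)"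
      by (rule sum.cong) (simp_all add: d sym)
    finally show ?thesis by simp
  qed
  have cB: "(\<Sum>y\<in>B. G x y * c y) = (\<Sum>y\<in>B. G x y * c0 y) - t * (\<Sum>y\<in>B. G x y * d y)" for x
    unfolding c_def upd[of "\<lambda>r y. G x y * r"]
    by (simp add: algebra_simps sum_subtractf sum_distrib_left)
  have "(\<Sum>y\<in>insert b B. G x y * c y) = l x" if "x \<in> insert b B" for x
  proof -
    have eq: "(\<Sum>y\<in>insert b B. G x y * c y) =
        G x b * t + ((\<Sum>y\<in>B. G x y * c0 y) - t * (\<Sum>y\<in>B. G x y * d y))"
      using insert.hyps by (simp add: cB) (simp add: c_def)
    show ?thesis
    proof (cases "x = b")
      case True
      have "(\<Sum>y\<in>B. G b y * d y) = (\<Sum>y\<in>B. d y * G y b)"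
        by (rule sum.cong) (simp_all add: sym)
      then have "(\<Sum>y\<in>insert b B. G b y * c y) = t * s + (\<Sum>x\<in>B. d x * l x)"
        using eq True c0b by (simp add: s_def algebra_simps)
      with True ts show ?thesis by (simp add: r_def)
    next
      case False
      with that have "x \<in> B" by simp
      with eq show ?thesis by (simp add: c0 d)
    qed
  qed
  then show ?case by blast
qed

text \<open>Riesz representation for a possibly degenerate form: the coefficients of \<open>u\<close> in a finite spanning
set, which may be linearly dependent, solve its Gram system.\<close>

lemma riesz_semidefinite_finite_dim:
  fixes X :: "'x::real_vector set" and a :: "'x \<Rightarrow> 'x \<Rightarrow> real" and l :: "'x \<Rightarrow> real"
  assumes "finite_dim_subspace X"
    and sym: "\<And>v w. v \<in> X \<Longrightarrow> w \<in> X \<Longrightarrow> a v w = a w v"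
    and add: "\<And>u v w. u \<in> X \<Longrightarrow> v \<in> X \<Longrightarrow> w \<in> X \<Longrightarrow> a (u + v) w = a u w + a v w"
    and scale: "\<And>c v w. v \<in> X \<Longrightarrow> w \<in> X \<Longrightarrow> a (c *\<^sub>R v) w = c * a v w"
    and psd: "\<And>v. v \<in> X \<Longrightarrow> 0 \<le> a v v"
    and ladd: "\<And>v w. v \<in> X \<Longrightarrow> w \<in> X \<Longrightarrow> l (v + w) = l v + l w"
    and lscale: "\<And>c v. v \<in> X \<Longrightarrow> l (c *\<^sub>R v) = c * l v"
    and ker: "\<And>v. v \<in> X \<Longrightarrow> a v v = 0 \<Longrightarrow> l v = 0"
  obtains u where "u \<in> X" "\<And>v. v \<in> X \<Longrightarrow> a u v = l v"
proof -
  obtain B where B: "finite B" "X = span B"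
    using assms(1) by (auto simp: finite_dim_subspace_def)
  have subX: "subspace X" and BX: "B \<subseteq> X"
    using B by (auto simp: span_superset)
  have lin: "f (\<Sum>b\<in>S. c b *\<^sub>R b) = (\<Sum>b\<in>S. c b * f b)"
    if "\<And>v w. v \<in> X \<Longrightarrow> w \<in> X \<Longrightarrow> f (v + w) = f v + f w"
      and "\<And>c v. v \<in> X \<Longrightarrow> f (c *\<^sub>R v) = c * f v" and "S \<subseteq> B"
    for f :: "'x \<Rightarrow> real" and c S
    using finite_subset[OF \<open>S \<subseteq> B\<close> \<open>finite B\<close>] \<open>S \<subseteq> B\<close>
  proof (induction S rule: finite_induct)
    case empty
    show ?case using that(2)[of 0 0] subspace_0[OF subX] by simp
  next
    case (insert b S)
    have "(\<Sum>b\<in>S. c b *\<^sub>R b) \<in> X"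
      using insert BX by (intro subspace_sum subspace_scale subX) auto
    moreover have "b \<in> X" using insert BX by auto
    ultimately show ?case
      using insert by (simp add: that(1,2) subspace_scale[OF subX])
  qed
  define comb where "comb c = (\<Sum>b\<in>B. c b *\<^sub>R b)" for c :: "'x \<Rightarrow> real"
  have combX: "comb c \<in> X" for c
    unfolding comb_def using BX by (intro subspace_sum subspace_scale subX) auto
  have a1: "a (comb c) w = (\<Sum>b\<in>B. c b * a b w)" if "w \<in> X" for c w
    unfolding comb_def by (rule lin[of "\<lambda>v. a v w"]) (use add scale that in auto)
  have l1: "l (comb c) = (\<Sum>b\<in>B. c b * l b)" for c
    unfolding comb_def by (rule lin) (use ladd lscale in auto)
  have a2: "a (comb c) (comb c) = (\<Sum>x\<in>B. \<Sum>y\<in>B. c x * c y * a x y)" for c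
  proof -
    have "a x (comb c) = (\<Sum>y\<in>B. c y * a x y)" if "x \<in> B" for x
    proof -
      have "a x (comb c) = a (comb c) x" using sym combX BX that by blast
      also have "\<dots> = (\<Sum>y\<in>B. c y * a y x)" using a1 BX that by blast
      also have "\<dots> = (\<Sum>y\<in>B. c y * a x y)" using sym BX that by (intro sum.cong) (auto simp: subset_iff)
      finally show ?thesis .
    qed
    then show ?thesis
      using combX by (simp add: a1 sum_distrib_left mult.assoc)
  qed
  have "\<exists>c. \<forall>x\<in>B. (\<Sum>y\<in>B. a x y * c y) = l x"
  proof (rule semidefinite_system_solvable)
    show "a x y = a y x" if "x \<in> B" "y \<in> B" for x y
      using that BX sym by blast
    show "0 \<le> (\<Sum>x\<in>B. \<Sum>y\<in>B. c x * c y * a x y)" for c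
      using psd[OF combX] by (simp add: a2)
    show "(\<Sum>x\<in>B. c x * l x) = 0" if "(\<Sum>x\<in>B. \<Sum>y\<in>B. c x * c y * a x y) = 0" for c
      using ker[OF combX, of c] that by (simp add: a2 l1)
  qed (fact B)
  then obtain c where c: "\<And>x. x \<in> B \<Longrightarrow> (\<Sum>y\<in>B. a x y * c y) = l x"
    by blast
  have "a (comb c) v = l v" if "v \<in> X" for v
  proof -
    obtain d where v: "v = comb d"
      using \<open>v \<in> X\<close> B by (auto simp: comb_def span_finite)
    have "a (comb c) v = a v (comb c)"
      using sym combX \<open>v \<in> X\<close> by blast
    also have "\<dots> = (\<Sum>x\<in>B. d x * a x (comb c))"
      by (simp add: v a1 combX)
    also have "\<dots> = (\<Sum>x\<in>B. d x * l x)"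
    proof (rule sum.cong)
      fix x assume x: "x \<in> B"
      have "a x (comb c) = a (comb c) x" using sym combX BX x by blast
      also have "\<dots> = (\<Sum>y\<in>B. a x y * c y)"
        using x BX by (auto simp: a1 subset_iff intro!: sum.cong sym)
      finally show "d x * a x (comb c) = d x * l x" using c[OF x] by simp
    qed simp
    also have "\<dots> = l v" by (simp add: v l1)
    finally show ?thesis .
  qed
  with combX show thesis by (blast intro: that)
qed

section \<open>Polynomials\<close>

lemma finite_monomials [simp]: "finite (monomials m)"
  by (rule finite_subset[of _ "{..m} \<times> {..m}"]) (auto simp: monomials_def)

lemma polys_add: "p \<in> polys m \<Longrightarrow> q \<in> polys m \<Longrightarrow> (\<lambda>x. p x + q x) \<in> polys m"
proof -
  assume "p \<in> polys m" "q \<in> polys m"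
  then obtain c d where "p = (\<lambda>x. \<Sum>(a, b)\<in>monomials m. c a b * (x $ 1) ^ a * (x $ 2) ^ b)"
    "q = (\<lambda>x. \<Sum>(a, b)\<in>monomials m. d a b * (x $ 1) ^ a * (x $ 2) ^ b)"
    by (auto simp: polys_def)
  then have "(\<lambda>x. p x + q x) = (\<lambda>x. \<Sum>(a, b)\<in>monomials m. (c a b + d a b) * (x $ 1) ^ a * (x $ 2) ^ b)"
    by (simp add: fun_eq_iff sum.distrib[symmetric] case_prod_beta algebra_simps)
  then show ?thesis by (auto simp: polys_def intro!: exI[of _ "\<lambda>a b. c a b + d a b"])
qed

lemma polys_scale: "p \<in> polys m \<Longrightarrow> (\<lambda>x. k * p x) \<in> polys m"
proof -
  assume "p \<in> polys m"
  then obtain c where "p = (\<lambda>x. \<Sum>(a, b)\<in>monomials m. c a b * (x $ 1) ^ a * (x $ 2) ^ b)"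
    by (auto simp: polys_def)
  then have "(\<lambda>x. k * p x) = (\<lambda>x. \<Sum>(a, b)\<in>monomials m. (k * c a b) * (x $ 1) ^ a * (x $ 2) ^ b)"
    by (simp add: fun_eq_iff sum_distrib_left case_prod_beta algebra_simps)
  then show ?thesis by (auto simp: polys_def intro!: exI[of _ "\<lambda>a b. k * c a b"])
qed

text \<open>Products, and through them affine substitutions, are expanded into sums of such terms.\<close>

lemma polys_monomial:
  assumes "a + b \<le> m"
  shows "(\<lambda>x. k * (x $ 1) ^ a * (x $ 2) ^ b) \<in> polys m"
proof -
  have "(\<Sum>(a', b')\<in>monomials m. (if (a', b') = (a, b) then k else 0) * (x $ 1) ^ a' * (x $ 2) ^ b') =
      k * (x $ 1) ^ a * (x $ 2) ^ b" for x :: "real^2"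
  proof -
    have "(\<Sum>(a', b')\<in>monomials m. (if (a', b') = (a, b) then k else 0) * (x $ 1) ^ a' * (x $ 2) ^ b') =
        (\<Sum>z\<in>monomials m. if z = (a, b) then k * (x $ 1) ^ a * (x $ 2) ^ b else 0)"
      by (rule sum.cong) (auto split: if_splits)
    then show ?thesis using assms by (simp add: sum.delta) (simp add: monomials_def)
  qed
  then show ?thesis
    unfolding polys_def
    by (intro CollectI exI[of _ "\<lambda>a' b'. if (a', b') = (a, b) then k else 0"]) (simp add: fun_eq_iff)
qed

lemma polys_const: "(\<lambda>x. k) \<in> polys m"
  using polys_monomial[of 0 0 m k] by simp

lemma polys_sum:
  assumes "\<And>i. i \<in> S \<Longrightarrow> p i \<in> polys m"
  shows "(\<lambda>x. \<Sum>i\<in>S. p i x) \<in> polys m"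
proof (cases "finite S")
  case True
  then show ?thesis
    using assms by (induction S rule: finite_induct) (auto intro: polys_const polys_add)
qed (simp add: polys_const)

lemma polysE:
  assumes "p \<in> polys m"
  obtains c where "p = (\<lambda>x. \<Sum>z\<in>monomials m. c z * (x $ 1) ^ fst z * (x $ 2) ^ snd z)"
proof -
  from assms obtain c where "p = (\<lambda>x. \<Sum>(a, b)\<in>monomials m. c a b * (x $ 1) ^ a * (x $ 2) ^ b)"
    by (auto simp: polys_def)
  then show thesis
    by (intro that[of "\<lambda>z. c (fst z) (snd z)"]) (simp add: case_prod_beta)
qed

lemma polys_mult:
  assumes "p \<in> polys k" "q \<in> polys l"
  shows "(\<lambda>x. p x * q x) \<in> polys (k + l)"
proof -
  obtain c where p: "p = (\<lambda>x. \<Sum>z\<in>monomials k. c z * (x $ 1) ^ fst z * (x $ 2) ^ snd z)"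
    using polysE[OF assms(1)] .
  obtain d where q: "q = (\<lambda>x. \<Sum>z\<in>monomials l. d z * (x $ 1) ^ fst z * (x $ 2) ^ snd z)"
    using polysE[OF assms(2)] .
  have "(\<lambda>x. p x * q x) = (\<lambda>x. \<Sum>z\<in>monomials k. \<Sum>w\<in>monomials l.
      (c z * d w) * (x $ 1) ^ (fst z + fst w) * (x $ 2) ^ (snd z + snd w))"
    by (simp add: p q sum_product power_add ac_simps)
  also have "\<dots> \<in> polys (k + l)"
    by (intro polys_sum polys_monomial) (auto simp: monomials_def)
  finally show ?thesis .
qed

lemma polys_power:
  assumes "p \<in> polys 1"
  shows "(\<lambda>x. p x ^ a) \<in> polys a"
  by (induction a) (use polys_mult[OF assms] in \<open>auto simp: polys_const\<close>)

lemma polys_mono: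
  assumes "p \<in> polys k" "k \<le> m"
  shows "p \<in> polys m"
  using assms(2) polys_mult[OF assms(1) polys_const[of 1 "m - k"]] by simp

text \<open>Substituting an affine map does not raise the total degree. This lets estimates and unisolvence be
transported between a triangle and the reference triangle.\<close>

lemma polys_affine_comp:
  assumes "p \<in> polys m"
  shows "(\<lambda>x. p (A *v x + b)) \<in> polys m"
proof -
  obtain c where p: "p = (\<lambda>x. \<Sum>z\<in>monomials m. c z * (x $ 1) ^ fst z * (x $ 2) ^ snd z)"
    using polysE[OF assms] .
  have coord: "(\<lambda>x. (A *v x + b) $ i) \<in> polys 1" for i
  proof -
    have "(\<lambda>x. (A *v x + b) $ i) =
        (\<lambda>x. A $ i $ 1 * (x $ 1) ^ 1 * (x $ 2) ^ 0 + A $ i $ 2 * (x $ 1) ^ 0 * (x $ 2) ^ 1 + b $ i)"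
      by (simp add: fun_eq_iff matrix_vector_mult_def sum_2)
    also have "\<dots> \<in> polys 1"
      by (intro polys_add polys_monomial polys_const) auto
    finally show ?thesis .
  qed
  have "(\<lambda>x. c z * ((A *v x + b) $ 1) ^ fst z * ((A *v x + b) $ 2) ^ snd z) \<in> polys m"
    if "z \<in> monomials m" for z
  proof -
    have "(\<lambda>x. c z * (((A *v x + b) $ 1) ^ fst z * ((A *v x + b) $ 2) ^ snd z)) \<in> polys (fst z + snd z)"
      by (intro polys_scale polys_mult polys_power coord)
    with that show ?thesis
      by (auto simp: monomials_def mult.assoc intro: polys_mono)
  qed
  then show ?thesis unfolding p by (intro polys_sum)
qed

lemma continuous_on_polys: "p \<in> polys m \<Longrightarrow> continuous_on S p"
  by (auto simp: polys_def case_prod_beta intro!: continuous_intros)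

section \<open>Integrals of continuous functions on compact sets\<close>

lemma set_integrable_continuous_compact:
  fixes f :: "'a::euclidean_space \<Rightarrow> real"
  assumes "compact S" "continuous_on S f"
  shows "set_integrable lebesgue S f"
proof -
  have "integrable lborel (\<lambda>x. indicator S x *\<^sub>R f x)"
    using assms by (rule borel_integrable_compact)
  then show ?thesis
    unfolding set_integrable_def by (simp add: integrable_completion borel_measurable_integrable)
qed

text \<open>Convexity and nonempty interior make the set the closure of its interior; on a set with a
lower-dimensional part sticking out, the function could be positive there without being noticed by
the integral.\<close>

lemma continuous_nonneg_integral_zero:
  fixes f :: "'a::euclidean_space \<Rightarrow> real"
  assumes "compact S" "convex S" "interior S \<noteq> {}" "continuous_on S f"
    and "\<And>x. x \<in> S \<Longrightarrow> 0 \<le> f x" and "(LINT x:S|lebesgue. f x) = 0" and "x \<in> S"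
  shows "f x = 0"
proof (rule has_integral_0_closure_imp_0[of "interior S"])
  have cl: "closure (interior S) = S"
    using convex_closure_interior[OF assms(2,3)] compact_imp_closed[OF assms(1)] by simp
  have int: "set_integrable lebesgue S f"
    using assms(1,4) by (rule set_integrable_continuous_compact)
  show "continuous_on (closure (interior S)) f" using assms(4) by (simp add: cl)
  show "0 \<le> f x" if "x \<in> interior S" for x
    using assms(5) that interior_subset by blast
  have bd: "bounded S" using assms(1) by (rule compact_imp_bounded)
  show fin: "emeasure lborel (interior S) < \<infinity>"
    using bd emeasure_bounded_finite[of "interior S"] bounded_subset[OF _ interior_subset] by blast
  show "emeasure lborel (interior S) > 0"
  proof (rule ccontr)
    assume "\<not> 0 < emeasure lborel (interior S)"
    then have "interior S \<in> null_sets lborel"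
      by (simp add: null_setsI)
    then have "negligible (interior S)"
      by (simp add: negligible_iff_null_sets null_sets_completionI)
    then show False
      using open_not_negligible[OF open_interior] assms(3) by blast
  qed
  show "(f has_integral 0) (closure (interior S))"
    using has_integral_set_lebesgue[OF int] assms(6) by (simp add: cl)
  show "x \<in> closure (interior S)" using assms(7) by (simp add: cl)
  have "measure lebesgue (interior S) = measure lebesgue S"
    using bd negligible_convex_frontier[OF assms(2)] by (rule measure_interior)
  then have "emeasure lebesgue S = emeasure lebesgue (interior S)"
    using assms(1) bd
    by (simp add: emeasure_eq_measure2 lmeasurable_compact lmeasurable_interior)
  then show "emeasure lborel (closure (interior S)) = emeasure lborel (interior S)"
    using assms(1) by (simp add: cl compact_imp_closed borel_closed)
qed auto

lemma set_integral_add_continuous: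
  fixes f g :: "'a::euclidean_space \<Rightarrow> real"
  assumes "compact S" "continuous_on S f" "continuous_on S g"
  shows "(LINT x:S|lebesgue. f x + g x) = (LINT x:S|lebesgue. f x) + (LINT x:S|lebesgue. g x)"
  using assms by (intro set_integral_add set_integrable_continuous_compact)

lemma set_integral_sum_continuous:
  fixes f :: "'i \<Rightarrow> 'a::euclidean_space \<Rightarrow> real"
  assumes "compact S" "\<And>i. i \<in> J \<Longrightarrow> continuous_on S (f i)"
  shows "(LINT x:S|lebesgue. \<Sum>i\<in>J. f i x) = (\<Sum>i\<in>J. LINT x:S|lebesgue. f i x)"
proof (cases "finite J")
  case True
  then show ?thesis using assms(2)
  proof (induction J rule: finite_induct)
    case empty
    then show ?case by (simp add: set_lebesgue_integral_def)
  next
    case (insert j J)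
    then show ?case
      using assms(1) by (simp add: set_integral_add_continuous continuous_on_sum)
  qed
qed (simp add: set_lebesgue_integral_def)

lemma set_integral_mono_continuous:
  fixes f g :: "'a::euclidean_space \<Rightarrow> real"
  assumes "compact S" "continuous_on S f" "continuous_on S g" "\<And>x. x \<in> S \<Longrightarrow> f x \<le> g x"
  shows "(LINT x:S|lebesgue. f x) \<le> (LINT x:S|lebesgue. g x)"
  using assms by (intro set_integral_mono set_integrable_continuous_compact)

lemma set_integral_nonneg_real:
  fixes f :: "'a::euclidean_space \<Rightarrow> real"
  assumes "\<And>x. x \<in> S \<Longrightarrow> 0 \<le> f x"
  shows "0 \<le> (LINT x:S|lebesgue. f x)"
  unfolding set_lebesgue_integral_def
  by (rule integral_nonneg_AE) (use assms in \<open>auto simp: indicator_def\<close>)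

text \<open>The Cauchy--Schwarz inequality, weakened by the summand \<open>1\<close> so that \<open>r = 0\<close> needs no separate
treatment: nonnegativity of \<open>\<integral>(p - s r)\<^sup>2\<close> is used at \<open>s = \<integral>p r / (1 + \<integral>r\<^sup>2)\<close>.\<close>

lemma set_integral_square_product_bound:
  fixes p r :: "'a::euclidean_space \<Rightarrow> real"
  assumes "compact S" and p: "continuous_on S p" and r: "continuous_on S r"
  shows "(LINT x:S|lebesgue. p x * r x)\<^sup>2 \<le>
    ((LINT x:S|lebesgue. (r x)\<^sup>2) + 1) * (LINT x:S|lebesgue. (p x)\<^sup>2)"
proof -
  define P where "P = (LINT x:S|lebesgue. (p x)\<^sup>2)"
  define R where "R = (LINT x:S|lebesgue. (r x)\<^sup>2)"
  define c where "c = (LINT x:S|lebesgue. p x * r x)"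
  have R0: "0 \<le> R" unfolding R_def by (rule set_integral_nonneg_real) simp
  define s where "s = c / (R + 1)"
  define t where "t = - 2 * s"
  have "0 \<le> (LINT x:S|lebesgue. (p x - s * r x)\<^sup>2)"
    by (rule set_integral_nonneg_real) simp
  also have "\<dots> = (LINT x:S|lebesgue. ((p x)\<^sup>2 + t * (p x * r x)) + s\<^sup>2 * (r x)\<^sup>2)"
    by (simp add: t_def power2_eq_square algebra_simps)
  also have "\<dots> = P + t * c + s\<^sup>2 * R"
    by (simp add: P_def R_def c_def set_integral_add_continuous[OF assms(1)] continuous_intros p r)
  finally have "0 \<le> P - 2 * s * c + s\<^sup>2 * R" by (simp add: t_def)
  moreover have "s\<^sup>2 * R \<le> s * c"
  proof -
    have "s\<^sup>2 * R \<le> s\<^sup>2 * (R + 1)" by (simp add: mult_left_mono)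
    also have "\<dots> = s * c" using R0 by (simp add: s_def power2_eq_square)
    finally show ?thesis .
  qed
  ultimately have "s * c \<le> P" by linarith
  then show ?thesis
    using R0 by (simp add: s_def P_def R_def c_def power2_eq_square field_simps)
qed

section \<open>Nodal and integral norms on the reference triangle\<close>

lemma ref_triangle_eq: "ref_triangle = convex hull (insert 0 (Basis :: (real^2) set))"
proof -
  have "(Basis :: (real^2) set) = {axis 1 1, axis 2 1}"
    by (auto simp: Basis_vec_def UNIV_2)
  then show ?thesis by (simp add: ref_triangle_def)
qed

lemma compact_ref_triangle: "compact ref_triangle"
  unfolding ref_triangle_def by (intro finite_imp_compact_convex_hull) simp

lemma convex_ref_triangle: "convex ref_triangle"
  unfolding ref_triangle_def by simp

lemma interior_ref_triangle: "interior ref_triangle \<noteq> {}"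
  using interior_std_simplex_nonempty[where 'a = "real^2"] unfolding ref_triangle_eq by blast

lemma lagrange_basis:
  assumes "unisolvent_nodes m xr"
  obtains \<phi> where "\<And>j. \<phi> j \<in> polys m"
    and "\<And>i j. i \<in> {1..dim_polys m} \<Longrightarrow> \<phi> j (xr i) = (if i = j then 1 else 0)"
    and "\<And>p x. p \<in> polys m \<Longrightarrow> p x = (\<Sum>j\<in>{1..dim_polys m}. p (xr j) * \<phi> j x)"
proof -
  have ex: "\<exists>!p. p \<in> polys m \<and> (\<forall>j\<in>{1..dim_polys m}. p (xr j) = y j)" for y
    using assms by (auto simp: unisolvent_nodes_def)
  have "\<forall>j. \<exists>p. p \<in> polys m \<and> (\<forall>i\<in>{1..dim_polys m}. p (xr i) = (if i = j then 1 else 0))"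
  proof
    fix j
    show "\<exists>p. p \<in> polys m \<and> (\<forall>i\<in>{1..dim_polys m}. p (xr i) = (if i = j then 1 else 0))"
      using ex[of "\<lambda>i. if i = j then 1 else 0"] by (rule ex1_implies_ex)
  qed
  then obtain \<phi> where \<phi>: "\<And>j. \<phi> j \<in> polys m"
    "\<And>i j. i \<in> {1..dim_polys m} \<Longrightarrow> \<phi> j (xr i) = (if i = j then 1 else 0)"
    by metis
  have "p = (\<lambda>x. \<Sum>j\<in>{1..dim_polys m}. p (xr j) * \<phi> j x)" if p: "p \<in> polys m" for p
  proof -
    have "(\<lambda>x. \<Sum>j\<in>{1..dim_polys m}. p (xr j) * \<phi> j x) \<in> polys m"
      by (intro polys_sum polys_scale \<phi>)
    moreover have "(\<Sum>j\<in>{1..dim_polys m}. p (xr j) * \<phi> j (xr i)) = p (xr i)"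
      if "i \<in> {1..dim_polys m}" for i
    proof -
      have "(\<Sum>j\<in>{1..dim_polys m}. p (xr j) * \<phi> j (xr i)) =
          (\<Sum>j\<in>{1..dim_polys m}. if i = j then p (xr j) else 0)"
        by (rule sum.cong) (simp_all only: \<phi>(2)[OF that], simp)
      with that show ?thesis by (simp add: sum.delta')
    qed
    ultimately show ?thesis
      using ex[of "\<lambda>j. p (xr j)"] p by blast
  qed
  from fun_cong[OF this] \<phi> show thesis by (intro that)
qed

text \<open>Both quantities are squared norms on a finite-dimensional space. The bound of the integral is read
off the expansion in the Lagrange basis \<open>\<phi>\<close>. For the converse, point evaluation at each node is
represented as \<open>p(x\<^sub>k) = \<integral>p r\<close> with a fixed polynomial \<open>r\<close>, whose coefficients solve the Gram system
of \<open>\<phi>\<close>; the system is consistent because a polynomial of vanishing \<open>L\<^sup>2\<close> norm vanishes on the triangle,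
in particular at its nodes.\<close>

lemma reference_nodal_equivalence:
  assumes uni: "unisolvent_nodes m xr"
  obtains C where "0 < C"
    and "\<And>p. p \<in> polys m \<Longrightarrow>
      (\<Sum>j\<in>{1..dim_polys m}. (p (xr j))\<^sup>2) \<le> C * (LINT x:ref_triangle|lebesgue. (p x)\<^sup>2)"
    and "\<And>p. p \<in> polys m \<Longrightarrow>
      (LINT x:ref_triangle|lebesgue. (p x)\<^sup>2) \<le> C * (\<Sum>j\<in>{1..dim_polys m}. (p (xr j))\<^sup>2)"
proof -
  define T where "T = ref_triangle"
  define N where "N = {1..dim_polys m}"
  have fN: "finite N" by (simp add: N_def)
  have T: "compact T" "convex T" "interior T \<noteq> {}"
    using compact_ref_triangle convex_ref_triangle interior_ref_triangle by (simp_all add: T_def)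
  obtain \<phi> where \<phi>: "\<And>j. \<phi> j \<in> polys m"
    and \<phi>n: "\<And>i j. i \<in> N \<Longrightarrow> \<phi> j (xr i) = (if i = j then 1 else 0)"
    and exp: "\<And>p x. p \<in> polys m \<Longrightarrow> p x = (\<Sum>j\<in>N. p (xr j) * \<phi> j x)"
    using lagrange_basis[OF uni] unfolding N_def by metis
  have cont: "continuous_on T (\<phi> j)" for j
    using \<phi> continuous_on_polys by blast
  have comb_node: "(\<Sum>j\<in>N. c j * \<phi> j (xr k)) = c k" if "k \<in> N" for c k
  proof -
    have "(\<Sum>j\<in>N. c j * \<phi> j (xr k)) = (\<Sum>j\<in>N. if k = j then c j else 0)"
      by (rule sum.cong) (simp_all only: \<phi>n[OF that], simp)
    with that fN show ?thesis by (simp add: sum.delta')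
  qed
  define G where "G i j = (LINT x:T|lebesgue. \<phi> i x * \<phi> j x)" for i j
  have prod_int: "(LINT x:T|lebesgue. (\<Sum>i\<in>N. a i * \<phi> i x) * (\<Sum>j\<in>N. b j * \<phi> j x)) =
      (\<Sum>i\<in>N. \<Sum>j\<in>N. a i * b j * G i j)" for a b
  proof -
    have "(LINT x:T|lebesgue. (\<Sum>i\<in>N. a i * \<phi> i x) * (\<Sum>j\<in>N. b j * \<phi> j x)) =
        (LINT x:T|lebesgue. (\<Sum>i\<in>N. \<Sum>j\<in>N. (a i * b j) * (\<phi> i x * \<phi> j x)))"
      by (simp add: sum_product ac_simps)
    also have "\<dots> = (\<Sum>i\<in>N. \<Sum>j\<in>N. (LINT x:T|lebesgue. (a i * b j) * (\<phi> i x * \<phi> j x)))"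
      using T(1) by (simp add: set_integral_sum_continuous continuous_intros cont)
    finally show ?thesis by (simp add: G_def)
  qed
  have dual: "\<exists>C\<ge>0. \<forall>p\<in>polys m. (p (xr k))\<^sup>2 \<le> C * (LINT x:T|lebesgue. (p x)\<^sup>2)" if k: "k \<in> N" for k
  proof -
    have sq: "(\<Sum>i\<in>N. \<Sum>j\<in>N. c i * c j * G i j) = (LINT x:T|lebesgue. (\<Sum>i\<in>N. c i * \<phi> i x)\<^sup>2)" for c
      by (simp add: prod_int power2_eq_square)
    have "\<exists>c. \<forall>i\<in>N. (\<Sum>j\<in>N. G i j * c j) = (if i = k then 1 else 0)"
    proof (rule semidefinite_system_solvable)
      show "G i j = G j i" for i j by (simp add: G_def mult.commute)
      show "0 \<le> (\<Sum>i\<in>N. \<Sum>j\<in>N. c i * c j * G i j)" for c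
        unfolding sq by (rule set_integral_nonneg_real) simp
      show "(\<Sum>i\<in>N. c i * (if i = k then 1 else 0)) = 0"
        if "(\<Sum>i\<in>N. \<Sum>j\<in>N. c i * c j * G i j) = 0" for c
      proof -
        have "xr k \<in> T" using uni k by (auto simp: unisolvent_nodes_def T_def N_def)
        then have "(\<Sum>i\<in>N. c i * \<phi> i (xr k))\<^sup>2 = 0"
          by (intro continuous_nonneg_integral_zero[OF T, where f = "\<lambda>x. (\<Sum>i\<in>N. c i * \<phi> i x)\<^sup>2"])
            (use that sq in \<open>auto intro!: continuous_intros cont\<close>)
        then show ?thesis using comb_node[OF k, of c] k fN by (simp add: if_distrib sum.delta cong: if_cong)
      qed
    qed (fact fN)
    then obtain c where c: "\<And>i. i \<in> N \<Longrightarrow> (\<Sum>j\<in>N. G i j * c j) = (if i = k then 1 else 0)"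
      by blast
    define r where "r x = (\<Sum>j\<in>N. c j * \<phi> j x)" for x
    have rep: "p (xr k) = (LINT x:T|lebesgue. p x * r x)" if p: "p \<in> polys m" for p
    proof -
      have "(LINT x:T|lebesgue. p x * r x) =
          (LINT x:T|lebesgue. (\<Sum>i\<in>N. p (xr i) * \<phi> i x) * (\<Sum>j\<in>N. c j * \<phi> j x))"
        by (simp only: r_def exp[OF p, symmetric])
      also have "\<dots> = (\<Sum>i\<in>N. p (xr i) * (\<Sum>j\<in>N. G i j * c j))"
        unfolding prod_int by (simp add: sum_distrib_left ac_simps)
      also have "\<dots> = (\<Sum>i\<in>N. if k = i then p (xr i) else 0)"
        by (rule sum.cong) (auto simp: c)
      finally show ?thesis using k fN by (simp add: sum.delta')
    qed
    define C where "C = (LINT x:T|lebesgue. (r x)\<^sup>2) + 1"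
    have "0 \<le> C" unfolding C_def by (intro add_nonneg_nonneg set_integral_nonneg_real) auto
    moreover have "(p (xr k))\<^sup>2 \<le> C * (LINT x:T|lebesgue. (p x)\<^sup>2)" if p: "p \<in> polys m" for p
      unfolding rep[OF p] C_def r_def
      by (intro set_integral_square_product_bound T continuous_intros cont continuous_on_polys[OF p])
    ultimately show ?thesis by blast
  qed
  then obtain C1 where C1: "\<And>k. k \<in> N \<Longrightarrow> 0 \<le> C1 k"
    "\<And>k p. k \<in> N \<Longrightarrow> p \<in> polys m \<Longrightarrow> (p (xr k))\<^sup>2 \<le> C1 k * (LINT x:T|lebesgue. (p x)\<^sup>2)"
    by metis
  define C2 where "C2 = (\<Sum>j\<in>N. LINT x:T|lebesgue. (\<phi> j x)\<^sup>2)"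
  have C2: "0 \<le> C2" unfolding C2_def by (intro sum_nonneg set_integral_nonneg_real) simp
  have C1s: "0 \<le> sum C1 N" by (intro sum_nonneg C1)
  show thesis
  proof (rule that[of "sum C1 N + C2 + 1"])
    show "0 < sum C1 N + C2 + 1" using C1s C2 by linarith
    fix p assume p: "p \<in> polys m"
    have P0: "0 \<le> (LINT x:T|lebesgue. (p x)\<^sup>2)" by (rule set_integral_nonneg_real) simp
    have "(\<Sum>j\<in>N. (p (xr j))\<^sup>2) \<le> sum C1 N * (LINT x:T|lebesgue. (p x)\<^sup>2)"
      unfolding sum_distrib_right by (intro sum_mono C1 p)
    also have "\<dots> \<le> (sum C1 N + C2 + 1) * (LINT x:T|lebesgue. (p x)\<^sup>2)"
      using C2 P0 by (intro mult_right_mono) auto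
    finally show "(\<Sum>j\<in>{1..dim_polys m}. (p (xr j))\<^sup>2) \<le>
        (sum C1 N + C2 + 1) * (LINT x:ref_triangle|lebesgue. (p x)\<^sup>2)"
      by (simp add: N_def T_def)
    have S0: "0 \<le> (\<Sum>j\<in>N. (p (xr j))\<^sup>2)" by (simp add: sum_nonneg)
    have "(LINT x:T|lebesgue. (p x)\<^sup>2) \<le>
        (LINT x:T|lebesgue. (\<Sum>j\<in>N. (p (xr j))\<^sup>2) * (\<Sum>j\<in>N. (\<phi> j x)\<^sup>2))"
    proof (intro set_integral_mono_continuous T continuous_intros cont continuous_on_polys[OF p])
      fix x
      show "(p x)\<^sup>2 \<le> (\<Sum>j\<in>N. (p (xr j))\<^sup>2) * (\<Sum>j\<in>N. (\<phi> j x)\<^sup>2)"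
        unfolding exp[OF p, of x] by (rule Cauchy_Schwarz_ineq_sum)
    qed
    also have "\<dots> = (\<Sum>j\<in>N. (p (xr j))\<^sup>2) * C2"
      using T(1) by (simp add: C2_def set_integral_sum_continuous continuous_intros cont)
    also have "\<dots> \<le> (sum C1 N + C2 + 1) * (\<Sum>j\<in>N. (p (xr j))\<^sup>2)"
      using mult_right_mono[OF _ S0, of C2 "sum C1 N + C2 + 1"] C1s by (simp add: mult.commute)
    finally show "(LINT x:ref_triangle|lebesgue. (p x)\<^sup>2) \<le>
        (sum C1 N + C2 + 1) * (\<Sum>j\<in>{1..dim_polys m}. (p (xr j))\<^sup>2)"
      by (simp add: N_def T_def)
  qed
qed

section \<open>Uniform equivalence on the triangles of a mesh\<close>

text \<open>The general change of variables formula concerns vector-valued integrands, so the real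
integrand is viewed as a vector of dimension one.\<close>

lemma set_integral_affine_image:
  fixes f :: "real^2 \<Rightarrow> real" and A :: "real^2^2"
  assumes "det A \<noteq> 0" "compact S" "continuous_on UNIV f"
  shows "(LINT x:(\<lambda>x. A *v x + b) ` S|lebesgue. f x) =
    \<bar>det A\<bar> * (LINT x:S|lebesgue. f (A *v x + b))"
proof -
  define F where "F = (\<lambda>x. A *v x + b)"
  have contF: "continuous_on X F" for X
    unfolding F_def by (intro continuous_intros linear_continuous_on_compose[of X "\<lambda>x. x"]) auto
  have injF: "inj_on F S"
  proof -
    have "inj ((*v) A)"
      using assms(1) by (simp add: inj_matrix_vector_mult invertible_det_nz)
    then show ?thesis by (auto simp: F_def inj_on_def inj_def)
  qed
  have contf: "continuous_on X f" for X using assms(3) continuous_on_subset by blast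
  have cfF: "continuous_on S (\<lambda>x. f (F x))"
    by (rule continuous_on_compose2[OF assms(3) contF]) auto
  have int: "set_integrable lebesgue S (\<lambda>x. \<bar>det A\<bar> * f (F x))"
    by (intro set_integrable_continuous_compact assms continuous_intros cfF)
  have intK: "set_integrable lebesgue (F ` S) f"
    by (intro set_integrable_continuous_compact contf compact_continuous_image contF assms)
  have vec_int: "(\<lambda>x. vec (g x) :: real^1) absolutely_integrable_on X \<and>
      integral X (\<lambda>x. vec (g x) :: real^1) = vec (integral X g)"
    if "g absolutely_integrable_on X" for g :: "real^2 \<Rightarrow> real" and X
  proof -
    have bl: "bounded_linear (vec :: real \<Rightarrow> real^1)"
      by (intro linear_conv_bounded_linear[THEN iffD1] linearI) (simp_all add: vec_eq_iff)
    show ?thesis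
      using absolutely_integrable_linear[OF that bl]
        integral_linear[OF set_lebesgue_integral_eq_integral(1)[OF that] bl]
      by (simp add: o_def)
  qed
  have "(\<lambda>x. \<bar>det (matrix ((*v) A))\<bar> *\<^sub>R (vec (f (F x)) :: real^1)) absolutely_integrable_on S \<and>
      integral S (\<lambda>x. \<bar>det (matrix ((*v) A))\<bar> *\<^sub>R (vec (f (F x)) :: real^1)) = vec (integral (F ` S) f)
      \<longleftrightarrow> (\<lambda>x. vec (f x) :: real^1) absolutely_integrable_on (F ` S) \<and>
        integral (F ` S) (\<lambda>x. vec (f x) :: real^1) = vec (integral (F ` S) f)"
  proof (rule has_absolute_integral_change_of_variables)
    show "S \<in> sets lebesgue" using assms(2) by (simp add: compact_imp_closed borel_closed)
    show "(F has_derivative (*v) A) (at x within S)" for x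
      unfolding F_def by (auto intro!: derivative_eq_intros bounded_linear_imp_has_derivative
        linear_conv_bounded_linear[THEN iffD1])
  qed (fact injF)
  with vec_int[OF intK] have "integral S (\<lambda>x. \<bar>det A\<bar> *\<^sub>R (vec (f (F x)) :: real^1)) =
      vec (integral (F ` S) f)"
    by simp
  moreover have "(\<lambda>x. \<bar>det A\<bar> *\<^sub>R (vec (f (F x)) :: real^1)) = (\<lambda>x. vec (\<bar>det A\<bar> * f (F x)))"
    by (simp add: fun_eq_iff vec_eq_iff)
  ultimately have "(vec (integral S (\<lambda>x. \<bar>det A\<bar> * f (F x))) :: real^1) = vec (integral (F ` S) f)"
    using vec_int[OF int] by simp
  then have "integral S (\<lambda>x. \<bar>det A\<bar> * f (F x)) = integral (F ` S) f"
    by (simp add: vec_eq_iff)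
  then show ?thesis
    using set_lebesgue_integral_eq_integral(2)[OF int] set_lebesgue_integral_eq_integral(2)[OF intK]
    by (simp add: F_def)
qed

text \<open>This includes singular \<open>A\<close>, which is how a triangle of positive area is seen to have
an invertible reference map.\<close>

lemma measure_affine_image:
  fixes A :: "real^2^2"
  assumes "S \<in> lmeasurable"
  shows "measure lebesgue ((\<lambda>x. A *v x + b) ` S) = \<bar>det A\<bar> * measure lebesgue S"
proof -
  have "(\<lambda>x. A *v x + b) ` S = (+) b ` ((*v) A ` S)"
    by (simp add: image_image add.commute)
  moreover have "measure lebesgue ((*v) A ` S) = \<bar>det A\<bar> * measure lebesgue S"
    using measure_linear_image[OF matrix_vector_mul_linear assms, of A] by simp
  ultimately show ?thesis by (simp add: measure_translation)
qed

lemma measure_simplex_bounds: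
  fixes K :: "(real^2) set"
  assumes "2 simplex K"
  shows "0 < measure lebesgue K" "measure lebesgue K \<le> pi * (diameter K)\<^sup>2" "0 < diameter K"
proof -
  have K: "compact K" "convex K"
    using assms compact_simplex convex_simplex by blast+
  have ne: "K \<noteq> {}" using assms by auto
  have "rel_interior K \<noteq> {}" using K(2) ne by (simp add: rel_interior_eq_empty)
  then have "interior K \<noteq> {}"
    using aff_dim_simplex[OF assms] by (simp add: interior_rel_interior_gen)
  then have "\<not> negligible K" using negligible_convex_interior[OF K(2)] by simp
  then have "measure lebesgue K \<noteq> 0"
    using K(1) lmeasurable_compact negligible_iff_measure0 by blast
  then show pos: "0 < measure lebesgue K" by (simp add: zero_less_measure_iff)
  obtain x where x: "x \<in> K" using ne by blast
  have bd: "bounded K" using K(1) by (rule compact_imp_bounded)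
  have d0: "0 \<le> diameter K" using bd by (rule diameter_ge_0)
  have "K \<subseteq> cball x (diameter K)"
    using diameter_bounded_bound[OF bd x] by auto
  then have "measure lebesgue K \<le> measure lebesgue (cball x (diameter K))"
    using K(1) by (intro measure_mono_fmeasurable) (auto simp: compact_imp_closed borel_closed lmeasurable_cball)
  also have "\<dots> = pi * (diameter K)\<^sup>2"
    using content_cball[OF d0, of x] by (simp add: unit_ball_vol_2)
  finally show *: "measure lebesgue K \<le> pi * (diameter K)\<^sup>2" .
  with pos have "diameter K \<noteq> 0" by auto
  with d0 show "0 < diameter K" by simp
qed

lemma mesh_on_element:
  assumes "mesh_on \<Omega> M" "K \<in> elements M"
  obtains A b where "\<And>x. ref_map M K x = A *v x + b" "det A \<noteq> 0"
    "K = (\<lambda>x. A *v x + b) ` ref_triangle"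
    "measure lebesgue K = \<bar>det A\<bar> * measure lebesgue ref_triangle"
proof -
  obtain A b where F: "\<And>x. ref_map M K x = A *v x + b" and im: "ref_map M K ` ref_triangle = K"
    and s: "2 simplex K"
    using assms unfolding mesh_on_def by fast
  have K: "K = (\<lambda>x. A *v x + b) ` ref_triangle" using im F by auto
  have m: "measure lebesgue K = \<bar>det A\<bar> * measure lebesgue ref_triangle"
    unfolding K by (rule measure_affine_image) (simp add: compact_ref_triangle lmeasurable_compact)
  with measure_simplex_bounds(1)[OF s] have "det A \<noteq> 0" by auto
  from that[OF F this K m] show thesis .
qed

text \<open>The triangle contains balls of diameter arbitrarily close to that of the inscribed ball; half of it
is enough, which produces the constant \<open>\<pi> / (16 \<kappa>\<^sup>2)\<close>.\<close>

lemma shape_regular_measure_bound: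
  assumes "shape_regular I M" and "\<And>i. i \<in> I \<Longrightarrow> mesh_on \<Omega> (M i)"
  obtains c where "0 < c"
    "\<And>i K. i \<in> I \<Longrightarrow> K \<in> elements (M i) \<Longrightarrow> c * (diameter K)\<^sup>2 \<le> measure lebesgue K"
proof -
  obtain \<kappa> where \<kappa>: "\<kappa> > 0"
    "\<And>i K. i \<in> I \<Longrightarrow> K \<in> elements (M i) \<Longrightarrow> diameter K \<le> \<kappa> * inball_diameter K"
    using assms(1) unfolding shape_regular_def by blast
  have "pi / (16 * \<kappa>\<^sup>2) * (diameter K)\<^sup>2 \<le> measure lebesgue K"
    if i: "i \<in> I" and K: "K \<in> elements (M i)" for i K
  proof -
    have s: "2 simplex K" using assms(2)[OF i] K unfolding mesh_on_def by blast
    have cK: "compact K" using s by (rule compact_simplex)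
    have d: "0 < diameter K" using s by (rule measure_simplex_bounds)
    let ?S = "{2 * r |r. r \<ge> 0 \<and> (\<exists>c. cball c r \<subseteq> K)}"
    obtain x where "x \<in> K" using s by fastforce
    then have "cball x 0 \<subseteq> K" by simp
    then have ne: "?S \<noteq> {}" by blast
    have "0 < \<kappa> * inball_diameter K" using d \<kappa>(2)[OF i K] by linarith
    then have "0 < inball_diameter K" using \<kappa>(1) by (simp add: zero_less_mult_iff)
    then have "inball_diameter K / 2 < Sup ?S" by (simp add: inball_diameter_def)
    from less_cSupE[OF this ne]
    obtain t where "t \<in> ?S" and t: "inball_diameter K / 2 < t" .
    then obtain r c where r: "r \<ge> 0" "cball c r \<subseteq> K" "inball_diameter K / 2 < 2 * r"
      by auto
    have "diameter K \<le> 4 * \<kappa> * r"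
    proof -
      have "\<kappa> * inball_diameter K \<le> \<kappa> * (4 * r)"
        using r(3) \<kappa>(1) by (intro mult_left_mono) auto
      with \<kappa>(2)[OF i K] show ?thesis by (simp add: ac_simps)
    qed
    then have "(diameter K)\<^sup>2 \<le> (4 * \<kappa> * r)\<^sup>2" using d by (intro power_mono) auto
    then have "pi / (16 * \<kappa>\<^sup>2) * (diameter K)\<^sup>2 \<le> pi / (16 * \<kappa>\<^sup>2) * (4 * \<kappa> * r)\<^sup>2"
      by (intro mult_left_mono) auto
    also have "\<dots> = pi * r\<^sup>2" using \<kappa>(1) by (simp add: power_mult_distrib)
    also have "\<dots> = measure lebesgue (cball c r)"
      using content_cball[OF r(1), of c] by (simp add: unit_ball_vol_2)
    also have "\<dots> \<le> measure lebesgue K"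
      using r(2) cK by (intro measure_mono_fmeasurable) (auto simp: lmeasurable_compact lmeasurable_cball)
    finally show ?thesis .
  qed
  then show thesis using \<kappa>(1) by (intro that[of "pi / (16 * \<kappa>\<^sup>2)"]) auto
qed

text \<open>Scaling: the integral picks up the Jacobian determinant of the reference map, which is the ratio of
areas and hence comparable to \<open>h\<^sub>K\<^sup>2\<close>, exactly like the weights. The constant on the reference triangle
is thus transported to all triangles of all meshes.\<close>

lemma uniform_nodal_equivalence:
  assumes uni: "unisolvent_nodes m xr" and mesh: "\<And>i. i \<in> I \<Longrightarrow> mesh_on \<Omega> (M i)"
    and sr: "shape_regular I M" and w: "weights_ok m I M"
  obtains C where "0 < C"
    and "\<And>i K p. i \<in> I \<Longrightarrow> K \<in> elements (M i) \<Longrightarrow> p \<in> polys m \<Longrightarrow>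
      (\<Sum>j\<in>{1..dim_polys m}. weight (M i) K j * (p (node xr (M i) K j))\<^sup>2) \<le>
        C * (LINT x:K|lebesgue. (p x)\<^sup>2)"
    and "\<And>i K p. i \<in> I \<Longrightarrow> K \<in> elements (M i) \<Longrightarrow> p \<in> polys m \<Longrightarrow>
      (LINT x:K|lebesgue. (p x)\<^sup>2) \<le>
        C * (\<Sum>j\<in>{1..dim_polys m}. weight (M i) K j * (p (node xr (M i) K j))\<^sup>2)"
proof -
  define N where "N = {1..dim_polys m}"
  define \<mu> where "\<mu> = measure lebesgue ref_triangle"
  obtain C0 where C0: "0 < C0"
    "\<And>p. p \<in> polys m \<Longrightarrow> (\<Sum>j\<in>N. (p (xr j))\<^sup>2) \<le> C0 * (LINT x:ref_triangle|lebesgue. (p x)\<^sup>2)"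
    "\<And>p. p \<in> polys m \<Longrightarrow> (LINT x:ref_triangle|lebesgue. (p x)\<^sup>2) \<le> C0 * (\<Sum>j\<in>N. (p (xr j))\<^sup>2)"
    using reference_nodal_equivalence[OF uni] unfolding N_def by metis
  obtain a where a: "0 < a"
    "\<And>i K. i \<in> I \<Longrightarrow> K \<in> elements (M i) \<Longrightarrow> a * (diameter K)\<^sup>2 \<le> measure lebesgue K"
    using shape_regular_measure_bound[OF sr mesh] by metis
  obtain cw Cw where cw: "cw > 0" "Cw > 0"
    "\<And>i K j. i \<in> I \<Longrightarrow> K \<in> elements (M i) \<Longrightarrow> j \<in> N \<Longrightarrow> cw * (diameter K)\<^sup>2 \<le> weight (M i) K j"
    "\<And>i K j. i \<in> I \<Longrightarrow> K \<in> elements (M i) \<Longrightarrow> j \<in> N \<Longrightarrow> weight (M i) K j \<le> Cw * (diameter K)\<^sup>2"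
    using w unfolding weights_ok_def N_def by blast
  have \<mu>: "0 < \<mu>"
    unfolding \<mu>_def
    using negligible_convex_interior[OF convex_ref_triangle] interior_ref_triangle
      negligible_iff_measure0[OF lmeasurable_compact[OF compact_ref_triangle]]
    by (simp add: zero_less_measure_iff)
  have main: "(\<Sum>j\<in>N. weight (M i) K j * (p (node xr (M i) K j))\<^sup>2) \<le>
        Cw * C0 * \<mu> / a * (LINT x:K|lebesgue. (p x)\<^sup>2) \<and>
      (LINT x:K|lebesgue. (p x)\<^sup>2) \<le>
        pi * C0 / (\<mu> * cw) * (\<Sum>j\<in>N. weight (M i) K j * (p (node xr (M i) K j))\<^sup>2)"
    if i: "i \<in> I" and K: "K \<in> elements (M i)" and p: "p \<in> polys m" for i K p
  proof -
    obtain A b where F: "\<And>x. ref_map (M i) K x = A *v x + b" "det A \<noteq> 0"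
      "K = (\<lambda>x. A *v x + b) ` ref_triangle" and mK: "measure lebesgue K = \<bar>det A\<bar> * \<mu>"
      using mesh_on_element[OF mesh[OF i] K] unfolding \<mu>_def by metis
    define q where "q x = p (A *v x + b)" for x
    have q: "q \<in> polys m" unfolding q_def using p by (rule polys_affine_comp)
    have node: "p (node xr (M i) K j) = q (xr j)" for j
      by (simp add: q_def node_def F(1))
    define d where "d = (diameter K)\<^sup>2"
    have s: "2 simplex K" using mesh[OF i] K unfolding mesh_on_def by blast
    have d: "0 < d" using measure_simplex_bounds(3)[OF s] by (simp add: d_def)
    define Q where "Q = (LINT x:ref_triangle|lebesgue. (q x)\<^sup>2)"
    define P where "P = (LINT x:K|lebesgue. (p x)\<^sup>2)"
    define S where "S = (\<Sum>j\<in>N. (q (xr j))\<^sup>2)"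
    have Q0: "0 \<le> Q" unfolding Q_def by (rule set_integral_nonneg_real) simp
    have S0: "0 \<le> S" unfolding S_def by (simp add: sum_nonneg)
    have PQ: "P = \<bar>det A\<bar> * Q"
      unfolding P_def Q_def q_def
      by (subst F(3), rule set_integral_affine_image)
        (auto intro!: F(2) compact_ref_triangle continuous_intros continuous_on_polys[OF p])
    have lo: "a * d \<le> \<bar>det A\<bar> * \<mu>" and hi: "\<bar>det A\<bar> * \<mu> \<le> pi * d"
      using a(2)[OF i K] measure_simplex_bounds(2)[OF s] by (simp_all add: mK d_def)
    have "(\<Sum>j\<in>N. weight (M i) K j * (q (xr j))\<^sup>2) \<le> (\<Sum>j\<in>N. Cw * d * (q (xr j))\<^sup>2)"
      unfolding d_def by (intro sum_mono mult_right_mono cw i K) auto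
    also have "\<dots> = Cw * d * S" by (simp add: S_def sum_distrib_left)
    also have "\<dots> \<le> Cw * d * (C0 * Q)"
      using C0(2)[OF q] cw d by (intro mult_left_mono) (auto simp: S_def Q_def)
    also have "\<dots> = Cw * C0 / a * ((a * d) * Q)" using a(1) by simp
    also have "\<dots> \<le> Cw * C0 / a * ((\<bar>det A\<bar> * \<mu>) * Q)"
      using lo Q0 cw C0 a(1) by (intro mult_left_mono mult_right_mono) auto
    finally have 1: "(\<Sum>j\<in>N. weight (M i) K j * (q (xr j))\<^sup>2) \<le> Cw * C0 * \<mu> / a * P"
      by (simp add: PQ ac_simps)
    have "P = (\<bar>det A\<bar> * \<mu>) * Q / \<mu>" using \<mu> by (simp add: PQ)
    also have "\<dots> \<le> (pi * d) * (C0 * S) / \<mu>"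
      using C0(3)[OF q] \<mu> Q0 d
      by (intro divide_right_mono mult_mono[OF hi]) (auto simp: S_def Q_def)
    also have "\<dots> = pi * C0 / (\<mu> * cw) * (cw * d * S)" using cw by simp
    also have "\<dots> \<le> pi * C0 / (\<mu> * cw) * (\<Sum>j\<in>N. weight (M i) K j * (q (xr j))\<^sup>2)"
    proof (rule mult_left_mono)
      show "cw * d * S \<le> (\<Sum>j\<in>N. weight (M i) K j * (q (xr j))\<^sup>2)"
        unfolding S_def sum_distrib_left d_def by (intro sum_mono mult_right_mono cw i K) auto
    qed (use C0(1) \<mu> cw in auto)
    finally have 2: "P \<le> pi * C0 / (\<mu> * cw) * (\<Sum>j\<in>N. weight (M i) K j * (q (xr j))\<^sup>2)" .
    show ?thesis using 1 2 by (simp add: node P_def)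
  qed
  define C where "C = Cw * C0 * \<mu> / a + pi * C0 / (\<mu> * cw)"
  have le: "Cw * C0 * \<mu> / a \<le> C" "pi * C0 / (\<mu> * cw) \<le> C" and C: "0 < C"
    using C0(1) a(1) cw(1,2) \<mu> by (simp_all add: C_def add_pos_pos)
  show thesis
  proof (rule that[OF C])
    fix i K p assume ikp: "i \<in> I" "K \<in> elements (M i)" "p \<in> polys m"
    have P0: "0 \<le> (LINT x:K|lebesgue. (p x)\<^sup>2)" by (rule set_integral_nonneg_real) simp
    have "0 \<le> weight (M i) K j" if "j \<in> N" for j
      using cw(3)[OF ikp(1,2) that] cw(1) order_trans[of 0 "cw * (diameter K)\<^sup>2"] by simp
    then have S0: "0 \<le> (\<Sum>j\<in>N. weight (M i) K j * (p (node xr (M i) K j))\<^sup>2)"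
      by (intro sum_nonneg mult_nonneg_nonneg) auto
    show "(\<Sum>j\<in>{1..dim_polys m}. weight (M i) K j * (p (node xr (M i) K j))\<^sup>2) \<le>
        C * (LINT x:K|lebesgue. (p x)\<^sup>2)"
      using main[OF ikp] mult_right_mono[OF le(1) P0] by (simp add: N_def)
    show "(LINT x:K|lebesgue. (p x)\<^sup>2) \<le>
        C * (\<Sum>j\<in>{1..dim_polys m}. weight (M i) K j * (p (node xr (M i) K j))\<^sup>2)"
      using main[OF ikp] mult_right_mono[OF le(2) S0] by (simp add: N_def)
  qed
qed

section \<open>Cofactor matrices and the Cordes inequality\<close>

text \<open>The symmetric part of the cofactor matrix, written out in entries so that it is linear, and hence
continuous, in \<open>P\<close>. Pairing \<open>cof P\<close> with symmetric matrices sees only this part, and the ellipticity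
bounds are likewise conditions on the symmetric part of \<open>P\<close>.\<close>

definition sym_cof :: "real^2^2 \<Rightarrow> real^2^2" where
  "sym_cof P = (\<chi> i j. if i = j then trace P - P $ i $ i else - (P $ 1 $ 2 + P $ 2 $ 1) / 2)"

lemma sym_cof_entries:
  "sym_cof P $ 1 $ 1 = P $ 2 $ 2" "sym_cof P $ 2 $ 2 = P $ 1 $ 1"
  "sym_cof P $ 1 $ 2 = - (P $ 1 $ 2 + P $ 2 $ 1) / 2" "sym_cof P $ 2 $ 1 = - (P $ 1 $ 2 + P $ 2 $ 1) / 2"
  by (simp_all add: sym_cof_def trace_def sum_2)

lemma inner_matrix_2:
  fixes A B :: "real^2^2"
  shows "A \<bullet> B = A $ 1 $ 1 * B $ 1 $ 1 + A $ 1 $ 2 * B $ 1 $ 2 + A $ 2 $ 1 * B $ 2 $ 1 + A $ 2 $ 2 * B $ 2 $ 2"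
  by (simp add: inner_vec_def sum_2)

lemma sym_matrix_iff: "sym_matrix W \<longleftrightarrow> W $ 1 $ 2 = W $ 2 $ 1"
  by (auto simp: sym_matrix_def transpose_def vec_eq_iff forall_2)

lemma sym_matrix_sym_cof: "sym_matrix (sym_cof P)"
  by (simp add: sym_matrix_iff sym_cof_entries)

lemma cof_entries:
  assumes "det P \<noteq> 0"
  shows "cof P $ 1 $ 1 = P $ 2 $ 2" "cof P $ 2 $ 2 = P $ 1 $ 1"
    "cof P $ 1 $ 2 = - P $ 2 $ 1" "cof P $ 2 $ 1 = - P $ 1 $ 2"
proof -
  define D where "D = det P"
  have D: "D \<noteq> 0" "P $ 1 $ 1 * P $ 2 $ 2 = D + P $ 1 $ 2 * P $ 2 $ 1"
    using assms by (simp_all add: D_def det_2)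
  define Q :: "real^2^2" where
    "Q = (\<chi> i j. (if i = j then trace P - P $ i $ i else - P $ i $ j) / D)"
  have "P ** Q = mat 1"
    using D by (simp add: vec_eq_iff forall_2 matrix_matrix_mult_def sum_2 mat_def Q_def trace_def field_simps)
  then have "Q ** P = mat 1" by (simp add: matrix_left_right_inverse)
  with \<open>P ** Q = mat 1\<close> have "P ** matrix_inv P = mat 1"
    using someI[of "\<lambda>A. P ** A = mat 1 \<and> A ** P = mat 1" Q] by (simp add: matrix_inv_def)
  then have "Q ** (P ** matrix_inv P) = Q" by simp
  then have "matrix_inv P = Q"
    using \<open>Q ** P = mat 1\<close> by (simp add: matrix_mul_assoc)
  then show "cof P $ 1 $ 1 = P $ 2 $ 2" "cof P $ 2 $ 2 = P $ 1 $ 1"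
    "cof P $ 1 $ 2 = - P $ 2 $ 1" "cof P $ 2 $ 1 = - P $ 1 $ 2"
    using D(1) by (simp_all add: cof_def transpose_def Q_def trace_def sum_2 D_def[symmetric])
qed

lemma cof_inner_sym:
  assumes "det P \<noteq> 0" "sym_matrix W"
  shows "cof P \<bullet> W = sym_cof P \<bullet> W"
  using assms(2) by (simp add: inner_matrix_2 cof_entries[OF assms(1)] sym_cof_entries sym_matrix_iff
      algebra_simps)

definition elliptic_between :: "real \<Rightarrow> real \<Rightarrow> real^2^2 \<Rightarrow> bool" where
  "elliptic_between \<nu>2 \<nu>1 P \<longleftrightarrow>
     (\<forall>\<xi>. \<nu>2 * (norm \<xi>)\<^sup>2 \<le> \<xi> \<bullet> (P *v \<xi>) \<and> \<xi> \<bullet> (P *v \<xi>) \<le> \<nu>1 * (norm \<xi>)\<^sup>2)"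

text \<open>The last inequality states that the symmetric part of \<open>P\<close> minus \<open>\<nu>2\<close> times the identity has nonnegative
determinant.\<close>

lemma elliptic_between_entries:
  assumes "elliptic_between \<nu>2 \<nu>1 P" "0 < \<nu>2"
  defines "a \<equiv> P $ 1 $ 1" and "d \<equiv> P $ 2 $ 2" and "s \<equiv> (P $ 1 $ 2 + P $ 2 $ 1) / 2"
  shows "\<nu>2 \<le> a" "a \<le> \<nu>1" "\<nu>2 \<le> d" "d \<le> \<nu>1" "s\<^sup>2 \<le> (a - \<nu>2) * (d - \<nu>2)"
proof -
  have q: "(vector [x, y] :: real^2) \<bullet> (P *v vector [x, y]) = a * x\<^sup>2 + 2 * s * x * y + d * y\<^sup>2"
    "(norm (vector [x, y] :: real^2))\<^sup>2 = x\<^sup>2 + y\<^sup>2" for x y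
    unfolding power2_norm_eq_inner
    by (simp_all add: inner_vec_def matrix_vector_mult_def sum_2 a_def d_def s_def
        power2_eq_square field_simps)
  have lo: "\<nu>2 * (x\<^sup>2 + y\<^sup>2) \<le> a * x\<^sup>2 + 2 * s * x * y + d * y\<^sup>2"
    and hi: "a * x\<^sup>2 + 2 * s * x * y + d * y\<^sup>2 \<le> \<nu>1 * (x\<^sup>2 + y\<^sup>2)" for x y
    using assms(1) unfolding elliptic_between_def q(1)[symmetric] q(2)[symmetric] by blast+
  show a: "\<nu>2 \<le> a" and "a \<le> \<nu>1" and d: "\<nu>2 \<le> d" and "d \<le> \<nu>1"
    using lo[of 1 0] hi[of 1 0] lo[of 0 1] hi[of 0 1] by simp_all
  define \<alpha> \<delta> where "\<alpha> = a - \<nu>2" and "\<delta> = d - \<nu>2"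
  have nn: "0 \<le> \<alpha> * x\<^sup>2 + 2 * s * x * y + \<delta> * y\<^sup>2" for x y
    using lo[of x y] by (simp add: \<alpha>_def \<delta>_def algebra_simps)
  have "s\<^sup>2 \<le> \<alpha> * \<delta>"
  proof (cases "\<alpha> = 0")
    case False
    then have "0 < \<alpha>" using a by (simp add: \<alpha>_def)
    \<comment> \<open>At \<open>(- s, \<alpha>)\<close> the form takes the value \<open>\<alpha>\<close> times its determinant.\<close>
    moreover have "0 \<le> \<alpha> * (\<alpha> * \<delta> - s\<^sup>2)"
      using nn[of "- s" \<alpha>] by (simp add: power2_eq_square algebra_simps)
    ultimately show ?thesis by (simp add: zero_le_mult_iff)
  next
    case True
    have "0 \<le> 2 * t * s + \<delta>" for t
      using nn[of t 1] True by (simp add: mult.commute mult.left_commute)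
    then have "s = 0" by (rule quadratic_nonneg_imp_linear_zero)
    with True show ?thesis by simp
  qed
  then show "s\<^sup>2 \<le> (a - \<nu>2) * (d - \<nu>2)" by (simp add: \<alpha>_def \<delta>_def)
qed

lemma elliptic_sym_cof_bounds:
  assumes "elliptic_between \<nu>2 \<nu>1 P" "0 < \<nu>2"
  shows "0 < det P" "\<nu>2\<^sup>2 \<le> det (sym_cof P)" "(norm (sym_cof P))\<^sup>2 \<le> 4 * \<nu>1\<^sup>2"
proof -
  define a d s where "a = P $ 1 $ 1" and "d = P $ 2 $ 2" and "s = (P $ 1 $ 2 + P $ 2 $ 1) / 2"
  have b: "\<nu>2 \<le> a" "a \<le> \<nu>1" "\<nu>2 \<le> d" "d \<le> \<nu>1" "s\<^sup>2 \<le> (a - \<nu>2) * (d - \<nu>2)"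
    using elliptic_between_entries[OF assms] by (simp_all add: a_def d_def s_def)
  have "\<nu>2 * \<nu>2 \<le> \<nu>2 * (a + d - \<nu>2)" using b assms(2) by (intro mult_left_mono) auto
  then have ds: "\<nu>2\<^sup>2 \<le> a * d - s\<^sup>2" using b(5) by (simp add: power2_eq_square algebra_simps)
  have "(sym_cof P) $ 1 $ 2 = - s" "(sym_cof P) $ 2 $ 1 = - s"
    unfolding s_def sym_cof_entries minus_divide_left by (rule refl)+
  note e = this sym_cof_entries(1,2)
  show "\<nu>2\<^sup>2 \<le> det (sym_cof P)"
    using ds by (simp add: det_2 e a_def d_def power2_eq_square mult.commute)
  have "det P = a * d - s\<^sup>2 + ((P $ 1 $ 2 - P $ 2 $ 1) / 2)\<^sup>2"
    by (simp add: det_2 a_def d_def s_def power2_eq_square field_simps)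
  moreover have "0 < \<nu>2\<^sup>2" using assms(2) by simp
  ultimately show "0 < det P" using ds by (metis add_pos_nonneg less_le_trans zero_le_power2)
  have "(a - \<nu>2) * (d - \<nu>2) \<le> \<nu>1 * \<nu>1" using b assms(2) by (intro mult_mono) auto
  then have "s\<^sup>2 \<le> \<nu>1\<^sup>2" using b(5) by (simp add: power2_eq_square)
  moreover have "a\<^sup>2 \<le> \<nu>1\<^sup>2" "d\<^sup>2 \<le> \<nu>1\<^sup>2" using b assms(2) by (auto intro!: power_mono)
  moreover have "(norm (sym_cof P))\<^sup>2 = a\<^sup>2 + d\<^sup>2 + 2 * s\<^sup>2"
    unfolding power2_norm_eq_inner by (simp add: inner_matrix_2 e a_def d_def power2_eq_square)
  ultimately show "(norm (sym_cof P))\<^sup>2 \<le> 4 * \<nu>1\<^sup>2" by linarith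
qed

lemma norm_sym_matrix_2:
  fixes A :: "real^2^2"
  assumes "sym_matrix A"
  shows "(norm A)\<^sup>2 = (trace A)\<^sup>2 - 2 * det A"
  using assms unfolding power2_norm_eq_inner
  by (simp add: inner_matrix_2 sym_matrix_iff det_2 trace_def sum_2 power2_eq_square algebra_simps)

text \<open>Young's inequality; working with squares and this splitting avoids the triangle inequality for the
broken norms.\<close>

lemma young_square:
  fixes x y \<eta> :: real
  assumes "0 < \<eta>"
  shows "(x + y)\<^sup>2 \<le> (1 + 1 / \<eta>) * x\<^sup>2 + (1 + \<eta>) * y\<^sup>2"
proof -
  have "0 \<le> (x / sqrt \<eta> - sqrt \<eta> * y)\<^sup>2" by simp
  also have "\<dots> = x\<^sup>2 / \<eta> + \<eta> * y\<^sup>2 - 2 * x * y"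
    using assms by (simp add: power2_diff power_divide power_mult_distrib)
  finally show ?thesis by (simp add: power2_sum algebra_simps)
qed

text \<open>The scaling \<open>\<gamma> = tr A / |A|\<^sup>2\<close> minimizes \<open>|I - \<gamma> A|\<close>, with minimum
\<open>|I - \<gamma> A|\<^sup>2 = 2 - (tr A)\<^sup>2 / |A|\<^sup>2 = 1 - 2 det A / |A|\<^sup>2\<close>; the last step, special to dimension two, uses
\<open>|A|\<^sup>2 = (tr A)\<^sup>2 - 2 det A\<close>. Ellipticity bounds this by \<open>1 - \<epsilon>\<close>. The squares of the two parts of
\<open>tr W = \<gamma> (A : W) + (I - \<gamma> A) : W\<close> are then separated at the cost of half of \<open>\<epsilon>\<close>.\<close>

lemma cordes_inequality:
  fixes P W :: "real^2^2"
  assumes ell: "elliptic_between \<nu>2 \<nu>1 P" "0 < \<nu>2"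
  defines "\<epsilon> \<equiv> \<nu>2\<^sup>2 / (2 * \<nu>1\<^sup>2)"
  shows "(trace W)\<^sup>2 \<le> (1 + 2 / \<epsilon>) / \<nu>2\<^sup>2 * (sym_cof P \<bullet> W)\<^sup>2 + (1 - \<epsilon> / 2) * (norm W)\<^sup>2"
proof -
  define A where "A = sym_cof P"
  define n where "n = (norm A)\<^sup>2"
  define \<gamma> where "\<gamma> = trace A / n"
  have A: "n = (trace A)\<^sup>2 - 2 * det A"
    unfolding n_def A_def by (intro norm_sym_matrix_2 sym_matrix_sym_cof)
  have b: "\<nu>2\<^sup>2 \<le> det A" "n \<le> 4 * \<nu>1\<^sup>2"
    using elliptic_sym_cof_bounds[OF ell] by (simp_all add: A_def n_def)
  have "2 * det A \<le> n"
  proof -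
    have "A $ 1 $ 2 = A $ 2 $ 1" using sym_matrix_sym_cof by (simp add: A_def sym_matrix_iff)
    then have "n - 2 * det A = (A $ 1 $ 1 - A $ 2 $ 2)\<^sup>2 + (2 * A $ 1 $ 2)\<^sup>2"
      unfolding A by (simp add: det_2 trace_def sum_2 power2_eq_square algebra_simps)
    moreover have "0 \<le> (A $ 1 $ 1 - A $ 2 $ 2)\<^sup>2 + (2 * A $ 1 $ 2)\<^sup>2" by simp
    ultimately show ?thesis by linarith
  qed
  moreover have nu: "0 < \<nu>2\<^sup>2" using ell(2) by simp
  ultimately have n: "0 < n" "2 * \<nu>2\<^sup>2 \<le> n" using b(1) by linarith+
  have nu1: "0 < \<nu>1\<^sup>2" using n b(2) by linarith
  have \<epsilon>: "0 < \<epsilon>" using nu nu1 by (simp add: \<epsilon>_def)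
  have "2 * \<nu>2\<^sup>2 * n \<le> 2 * det A * (4 * \<nu>1\<^sup>2)"
    using b nu n order_trans[OF less_imp_le[OF nu] b(1)] by (intro mult_mono) auto
  then have ratio: "\<epsilon> \<le> 2 * det A / n"
    using n nu1 by (simp add: \<epsilon>_def field_simps)
  have trI: "(mat 1 :: real^2^2) \<bullet> V = trace V" for V
    by (simp add: inner_matrix_2 mat_def trace_def sum_2)
  define E where "E = mat 1 - \<gamma> *\<^sub>R A"
  have "(norm E)\<^sup>2 = 2 - 2 * \<gamma> * trace A + \<gamma>\<^sup>2 * n"
    unfolding E_def power2_norm_eq_inner n_def
    by (simp add: inner_diff_left inner_diff_right trI inner_commute[of A "mat 1"] power2_eq_square
        algebra_simps) (simp add: trace_def sum_2 mat_def)
  also have "\<dots> = 2 - (trace A)\<^sup>2 / n"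
    using n by (simp add: \<gamma>_def power2_eq_square)
  also have "\<dots> = 1 - 2 * det A / n" using n A by (simp add: field_simps)
  finally have E: "(norm E)\<^sup>2 \<le> 1 - \<epsilon>" using ratio by simp
  have "\<gamma>\<^sup>2 = (n + 2 * det A) / n\<^sup>2" using A by (simp add: \<gamma>_def power_divide)
  also have "\<dots> \<le> 2 * n / n\<^sup>2" using \<open>2 * det A \<le> n\<close> by (intro divide_right_mono) auto
  also have "\<dots> = 2 / n" using n by (simp add: power2_eq_square)
  also have "\<dots> \<le> 1 / \<nu>2\<^sup>2" using frac_le[of 2 2 "2 * \<nu>2\<^sup>2" n] n nu by simp
  finally have \<gamma>: "\<gamma>\<^sup>2 \<le> 1 / \<nu>2\<^sup>2" .
  have "trace W = \<gamma> * (A \<bullet> W) + E \<bullet> W"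
    by (simp add: E_def inner_diff_left trI)
  then have "(trace W)\<^sup>2 \<le> (1 + 2 / \<epsilon>) * (\<gamma> * (A \<bullet> W))\<^sup>2 + (1 + \<epsilon> / 2) * (E \<bullet> W)\<^sup>2"
    using young_square[of "\<epsilon> / 2" "\<gamma> * (A \<bullet> W)" "E \<bullet> W"] \<epsilon> by simp
  also have "\<dots> \<le> (1 + 2 / \<epsilon>) * (1 / \<nu>2\<^sup>2 * (A \<bullet> W)\<^sup>2) + (1 + \<epsilon> / 2) * ((1 - \<epsilon>) * (norm W)\<^sup>2)"
  proof (intro add_mono mult_left_mono)
    show "(\<gamma> * (A \<bullet> W))\<^sup>2 \<le> 1 / \<nu>2\<^sup>2 * (A \<bullet> W)\<^sup>2"
      unfolding power_mult_distrib by (rule mult_right_mono[OF \<gamma>]) simp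
    have "(E \<bullet> W)\<^sup>2 \<le> (norm E)\<^sup>2 * (norm W)\<^sup>2"
      using Cauchy_Schwarz_ineq[of E W] by (simp add: power2_norm_eq_inner)
    also have "\<dots> \<le> (1 - \<epsilon>) * (norm W)\<^sup>2" using E by (rule mult_right_mono) simp
    finally show "(E \<bullet> W)\<^sup>2 \<le> (1 - \<epsilon>) * (norm W)\<^sup>2" .
  qed (use \<epsilon> in auto)
  also have "(1 + \<epsilon> / 2) * ((1 - \<epsilon>) * (norm W)\<^sup>2) \<le> (1 - \<epsilon> / 2) * (norm W)\<^sup>2"
  proof -
    have "(1 + \<epsilon> / 2) * (1 - \<epsilon>) \<le> 1 - \<epsilon> / 2" using \<epsilon> by (simp add: algebra_simps)
    from mult_right_mono[OF this, of "(norm W)\<^sup>2"] show ?thesis by (simp add: mult.assoc)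
  qed
  finally show ?thesis by (simp add: A_def)
qed

section \<open>Fields determined by their nodal values\<close>

lemma element_interpolant_ex1:
  assumes "unisolvent_nodes m xr" "mesh_on \<Omega> M" "K \<in> elements M"
  shows "\<exists>!p. p \<in> polys m \<and> (\<forall>j\<in>{1..dim_polys m}. p (node xr M K j) = y j)"
proof -
  obtain A b where F: "\<And>x. ref_map M K x = A *v x + b" "det A \<noteq> 0"
    using mesh_on_element[OF assms(2,3)] by metis
  obtain B where B: "A ** B = mat 1" "B ** A = mat 1"
    using F(2) by (auto simp: invertible_det_nz[symmetric] invertible_def)
  define F' where "F' x = B *v x + - (B *v b)" for x
  have FF': "ref_map M K (F' x) = x" "F' (ref_map M K x) = x" for x
    by (simp_all add: F F'_def matrix_vector_right_distrib matrix_vector_mul_assoc B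
        matrix_vector_mult_diff_distrib flip: diff_conv_add_uminus)
  have ex: "\<exists>!p. p \<in> polys m \<and> (\<forall>j\<in>{1..dim_polys m}. p (xr j) = y j)"
    using assms(1) unfolding unisolvent_nodes_def by blast
  then obtain p where p: "p \<in> polys m" "\<forall>j\<in>{1..dim_polys m}. p (xr j) = y j" by blast
  show ?thesis
  proof (rule ex1I[of _ "\<lambda>x. p (F' x)"], intro conjI ballI)
    show "(\<lambda>x. p (F' x)) \<in> polys m"
      unfolding F'_def using p(1) by (rule polys_affine_comp)
    show "p (F' (node xr M K j)) = y j" if "j \<in> {1..dim_polys m}" for j
      using p(2) that by (simp add: node_def FF')
    fix q assume q: "q \<in> polys m \<and> (\<forall>j\<in>{1..dim_polys m}. q (node xr M K j) = y j)"
    then have "(\<lambda>x. q (ref_map M K x)) \<in> polys m"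
      unfolding F(1) by (intro polys_affine_comp) blast
    moreover have "\<forall>j\<in>{1..dim_polys m}. q (ref_map M K (xr j)) = y j"
      using q by (simp add: node_def)
    ultimately have "(\<lambda>x. q (ref_map M K x)) = p" using ex p by blast
    then have "p (F' x) = q (ref_map M K (F' x))" for x by blast
    then show "q = (\<lambda>x. p (F' x))" by (simp add: FF')
  qed
qed

lemma Zh_interpolant_ex1:
  assumes "unisolvent_nodes m xr" "mesh_on \<Omega> M"
  shows "\<exists>!v. v \<in> Zh m M \<and>
    (\<forall>K\<in>elements M. \<forall>j\<in>{1..dim_polys m}. v K (node xr M K j) = y K j)"
proof -
  define P where "P K p \<longleftrightarrow> p \<in> polys m \<and> (\<forall>j\<in>{1..dim_polys m}. p (node xr M K j) = y K j)" for K p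
  have ex: "\<exists>!p. P K p" if "K \<in> elements M" for K
    unfolding P_def using element_interpolant_ex1[OF assms that] .
  define v where "v K = (if K \<in> elements M then (THE p. P K p) else (\<lambda>x. 0))" for K
  have v: "P K (v K)" if "K \<in> elements M" for K
    using theI'[OF ex[OF that]] that by (simp add: v_def)
  show ?thesis
  proof (rule ex1I[of _ v])
    show "v \<in> Zh m M \<and> (\<forall>K\<in>elements M. \<forall>j\<in>{1..dim_polys m}. v K (node xr M K j) = y K j)"
      using v by (auto simp: Zh_def P_def v_def)
    fix w assume w: "w \<in> Zh m M \<and> (\<forall>K\<in>elements M. \<forall>j\<in>{1..dim_polys m}. w K (node xr M K j) = y K j)"
    show "w = v"
    proof
      fix K
      show "w K = v K"
      proof (cases "K \<in> elements M")
        case True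
        then have "P K (w K)" using w by (auto simp: Zh_def P_def)
        with ex[OF True] v[OF True] show ?thesis by blast
      next
        case False
        with w show ?thesis by (simp add: Zh_def v_def)
      qed
    qed
  qed
qed

lemma interp_matrix_node:
  assumes "unisolvent_nodes m xr" "mesh_on \<Omega> M" "K \<in> elements M" "j \<in> {1..dim_polys m}"
  shows "interp_matrix m xr M G K (node xr M K j) = G (node xr M K j)"
proof -
  have "interp m xr M v K (node xr M K j) = v (node xr M K j)" for v
    using theI'[OF Zh_interpolant_ex1[OF assms(1,2), of "\<lambda>K j. v (node xr M K j)"]] assms(3,4)
    unfolding interp_def by blast
  then show ?thesis by (simp add: interp_matrix_def vec_eq_iff)
qed

text \<open>The interpolant is taken entrywise by a function \<open>v\<close> of the nodal data alone, so equal off-diagonal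
data give equal off-diagonal entries and the field is symmetric everywhere.\<close>

lemma Zh_sym_nodal_exists:
  assumes "unisolvent_nodes m xr" "mesh_on \<Omega> M" "\<And>K j. sym_matrix (Y K j)"
  shows "\<exists>V\<in>Zh_sym m M. \<forall>K\<in>elements M. \<forall>j\<in>{1..dim_polys m}. V K (node xr M K j) = Y K j"
proof -
  define v where "v y = (THE v. v \<in> Zh m M \<and>
    (\<forall>K\<in>elements M. \<forall>j\<in>{1..dim_polys m}. v K (node xr M K j) = y K j))" for y :: "_ \<Rightarrow> _ \<Rightarrow> real"
  have v: "v y \<in> Zh m M"
    "K \<in> elements M \<Longrightarrow> j \<in> {1..dim_polys m} \<Longrightarrow> v y K (node xr M K j) = y K j" for y K j
    using theI'[OF Zh_interpolant_ex1[OF assms(1,2), of y]] unfolding v_def by blast+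
  define V where "V K x = (\<chi> a b. v (\<lambda>K j. Y K j $ a $ b) K x)" for K x
  have "Y K j $ 1 $ 2 = Y K j $ 2 $ 1" for K j
    using assms(3) by (simp add: sym_matrix_iff)
  then have "sym_matrix (V K x)" for K x
    by (simp add: sym_matrix_iff V_def)
  moreover have "(\<lambda>K x. V K x $ a $ b) \<in> Zh m M" for a b
    using v(1)[of "\<lambda>K j. Y K j $ a $ b"] by (simp add: V_def)
  ultimately have "V \<in> Zh_sym m M" by (simp add: Zh_sym_def)
  moreover have "V K (node xr M K j) = Y K j" if "K \<in> elements M" "j \<in> {1..dim_polys m}" for K j
    using v(2)[OF that] by (simp add: V_def vec_eq_iff)
  ultimately show ?thesis by blast
qed

lemma Zh_sym_eqI:
  assumes "unisolvent_nodes m xr" "mesh_on \<Omega> M" "V \<in> Zh_sym m M" "W \<in> Zh_sym m M"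
    and eq: "\<And>K j. K \<in> elements M \<Longrightarrow> j \<in> {1..dim_polys m} \<Longrightarrow> V K (node xr M K j) = W K (node xr M K j)"
  shows "V = W"
proof -
  have "(\<lambda>K x. V K x $ a $ b) = (\<lambda>K x. W K x $ a $ b)" for a b
  proof -
    have "(\<lambda>K x. V K x $ a $ b) \<in> Zh m M" "(\<lambda>K x. W K x $ a $ b) \<in> Zh m M"
      using assms(3,4) by (simp_all add: Zh_sym_def)
    moreover have "\<forall>K\<in>elements M. \<forall>j\<in>{1..dim_polys m}.
        V K (node xr M K j) $ a $ b = W K (node xr M K j) $ a $ b"
      using eq by simp
    ultimately show ?thesis
      using Zh_interpolant_ex1[OF assms(1,2), of "\<lambda>K j. W K (node xr M K j) $ a $ b"] by blast
  qed
  then show ?thesis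
    by (auto simp: fun_eq_iff vec_eq_iff)
qed

lemma Zh_sym_diff:
  assumes "V \<in> Zh_sym m M" "W \<in> Zh_sym m M"
  shows "(\<lambda>K x. V K x - W K x) \<in> Zh_sym m M"
proof -
  have "(\<lambda>K x. v K x - w K x) \<in> Zh m M" if "v \<in> Zh m M" "w \<in> Zh m M" for v w
  proof -
    have "(\<lambda>x. v K x + (- 1) * w K x) \<in> polys m" if "K \<in> elements M" for K
      using \<open>v \<in> Zh m M\<close> \<open>w \<in> Zh m M\<close> that by (intro polys_add polys_scale) (auto simp: Zh_def)
    with that show ?thesis by (auto simp: Zh_def)
  qed
  with assms show ?thesis by (auto simp: Zh_sym_def sym_matrix_iff)
qed

lemma Zh_sym_inner_polys:
  assumes "V \<in> Zh_sym m M" "K \<in> elements M"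
  shows "(\<lambda>x. A \<bullet> V K x) \<in> polys m"
proof -
  have "(\<lambda>x. V K x $ a $ b) \<in> polys m" for a b
    using assms by (auto simp: Zh_sym_def Zh_def)
  then show ?thesis
    unfolding inner_matrix_2 by (intro polys_add polys_scale)
qed

section \<open>The discrete inner product\<close>

definition weights_positive :: "nat \<Rightarrow> mesh \<Rightarrow> bool" where
  "weights_positive m M \<longleftrightarrow> (\<forall>K\<in>elements M. \<forall>j\<in>{1..dim_polys m}. 0 < weight M K j)"

text \<open>A nondegenerate triangle has positive diameter, so the lower bound on the weights is positive.\<close>

lemma weights_ok_positive:
  assumes "weights_ok m I M" "i \<in> I" "mesh_on \<Omega> (M i)"
  shows "weights_positive m (M i)"
  unfolding weights_positive_def
proof (intro ballI)
  fix K j assume K: "K \<in> elements (M i)" and j: "j \<in> {1..dim_polys m}"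
  obtain c where "c > 0" "c * (diameter K)\<^sup>2 \<le> weight (M i) K j"
    using assms(1,2) K j unfolding weights_ok_def by blast
  moreover have "2 simplex K" using assms(3) K unfolding mesh_on_def by blast
  then have "0 < diameter K" by (rule measure_simplex_bounds)
  then have "0 < (diameter K)\<^sup>2" by simp
  ultimately show "0 < weight (M i) K j" by (meson less_le_trans mult_pos_pos)
qed

lemma inner_h_add_left: "inner_h m xr M (\<lambda>K x. U K x + V K x) W = inner_h m xr M U W + inner_h m xr M V W"
  by (simp add: inner_h_def inner_add_left algebra_simps sum.distrib)

lemma inner_h_diff_left: "inner_h m xr M (\<lambda>K x. U K x - V K x) W = inner_h m xr M U W - inner_h m xr M V W"
  by (simp add: inner_h_def inner_diff_left algebra_simps sum_subtractf)

lemma inner_h_scale_left: "inner_h m xr M (\<lambda>K x. c *\<^sub>R V K x) W = c * inner_h m xr M V W"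
  by (simp add: inner_h_def sum_distrib_left ac_simps)

lemma inner_h_commute: "inner_h m xr M V W = inner_h m xr M W V"
  by (simp add: inner_h_def inner_commute)

lemma inner_h_nonneg:
  assumes "weights_positive m M"
  shows "0 \<le> inner_h m xr M V V"
  using assms unfolding inner_h_def weights_positive_def
  by (intro sum_nonneg mult_nonneg_nonneg) (auto intro: less_imp_le)

lemma norm_h_square:
  assumes "weights_positive m M"
  shows "(norm_h m xr M V)\<^sup>2 = inner_h m xr M V V"
  by (simp add: norm_h_def inner_h_nonneg[OF assms])

lemma norm_h_nonneg [simp]:
  assumes "weights_positive m M"
  shows "0 \<le> norm_h m xr M V"
  by (simp add: norm_h_def inner_h_nonneg[OF assms])

lemma inner_h_Cauchy_Schwarz:
  assumes w: "weights_positive m M"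
  shows "(inner_h m xr M V W)\<^sup>2 \<le> inner_h m xr M V V * inner_h m xr M W W"
proof -
  define S where "S = elements M \<times> {1..dim_polys m}"
  define f where "f z = sqrt (weight M (fst z) (snd z)) * norm (V (fst z) (node xr M (fst z) (snd z)))" for z
  define g where "g z = sqrt (weight M (fst z) (snd z)) * norm (W (fst z) (node xr M (fst z) (snd z)))" for z
  have w0: "0 \<le> weight M (fst z) (snd z)" if "z \<in> S" for z
    using w that unfolding weights_positive_def S_def by (auto intro: less_imp_le)
  have eq: "inner_h m xr M U U' = (\<Sum>z\<in>S. weight M (fst z) (snd z) *
      (U (fst z) (node xr M (fst z) (snd z)) \<bullet> U' (fst z) (node xr M (fst z) (snd z))))" for U U' :: "'a broken"
    by (simp add: inner_h_def S_def sum.cartesian_product case_prod_beta)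
  have "\<bar>inner_h m xr M V W\<bar> \<le> (\<Sum>z\<in>S. f z * g z)"
    unfolding eq
  proof (rule order_trans[OF sum_abs sum_mono])
    fix z assume z: "z \<in> S"
    have "f z * g z = weight M (fst z) (snd z) *
        (norm (V (fst z) (node xr M (fst z) (snd z))) * norm (W (fst z) (node xr M (fst z) (snd z))))"
      using w0[OF z] by (simp add: f_def g_def)
    then show "\<bar>weight M (fst z) (snd z) *
      (V (fst z) (node xr M (fst z) (snd z)) \<bullet> W (fst z) (node xr M (fst z) (snd z)))\<bar> \<le> f z * g z"
      using w0[OF z] by (simp add: abs_mult mult_left_mono Cauchy_Schwarz_ineq2)
  qed
  then have "\<bar>inner_h m xr M V W\<bar>\<^sup>2 \<le> (\<Sum>z\<in>S. f z * g z)\<^sup>2"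
    by (rule power_mono) simp
  also have "\<dots> \<le> (\<Sum>z\<in>S. (f z)\<^sup>2) * (\<Sum>z\<in>S. (g z)\<^sup>2)"
    by (rule Cauchy_Schwarz_ineq_sum)
  also have "(\<Sum>z\<in>S. (f z)\<^sup>2) = inner_h m xr M V V"
    unfolding eq by (rule sum.cong) (simp_all add: f_def power_mult_distrib w0 power2_norm_eq_inner)
  also have "(\<Sum>z\<in>S. (g z)\<^sup>2) = inner_h m xr M W W"
    unfolding eq by (rule sum.cong) (simp_all add: g_def power_mult_distrib w0 power2_norm_eq_inner)
  finally show ?thesis by simp
qed

lemma inner_h_zero_imp:
  assumes "finite (elements M)" "weights_positive m M" "inner_h m xr M V V = 0"
    "K \<in> elements M" "j \<in> {1..dim_polys m}"
  shows "V K (node xr M K j) = 0"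
proof -
  have w: "0 < weight M K j" if "K \<in> elements M" "j \<in> {1..dim_polys m}" for K j
    using assms(2) that by (simp add: weights_positive_def)
  have nn: "0 \<le> weight M K j * (V K (node xr M K j) \<bullet> V K (node xr M K j))"
    if "K \<in> elements M" "j \<in> {1..dim_polys m}" for K j
    using w[OF that] by simp
  have "(\<Sum>j\<in>{1..dim_polys m}. weight M K j * (V K (node xr M K j) \<bullet> V K (node xr M K j))) = 0"
    using assms(3,4) sum_nonneg_eq_0_iff[OF assms(1)] nn unfolding inner_h_def
    by (metis (no_types, lifting) sum_nonneg)
  then have "weight M K j * (V K (node xr M K j) \<bullet> V K (node xr M K j)) = 0"
    using nn[OF assms(4)] assms(5) by (subst (asm) sum_nonneg_eq_0_iff) auto
  with w[OF assms(4,5)] show ?thesis by simp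
qed

section \<open>Projection onto the tangent space\<close>

text \<open>Since fields can be prescribed freely at the nodes and the inner product is a weighted sum over them,
the projection decouples: at each node it is the orthogonal projection onto the complement of \<open>A\<close>, and
the square of the removed component is \<open>(A : W)\<^sup>2 / |A|\<^sup>2\<close>. The matrix \<open>A\<close> stands for any symmetric
representative of the functional that defines the tangent space.\<close>

lemma norm_orth_proj_tangent:
  fixes A :: "(real^2) set \<Rightarrow> nat \<Rightarrow> real^2^2"
  assumes uni: "unisolvent_nodes m xr" and mesh: "mesh_on \<Omega> M" and w: "weights_positive m M"
    and W: "W \<in> Zh_sym m M"
    and A: "\<And>K j. sym_matrix (A K j)" "\<And>K j. K \<in> elements M \<Longrightarrow> j \<in> {1..dim_polys m} \<Longrightarrow> A K j \<noteq> 0"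
    and cof: "\<And>K j U. K \<in> elements M \<Longrightarrow> j \<in> {1..dim_polys m} \<Longrightarrow> sym_matrix U \<Longrightarrow>
      cof (P K (node xr M K j)) \<bullet> U = A K j \<bullet> U"
  shows "(norm_h m xr M (orth_proj m xr M (tangent_space m xr M P) W))\<^sup>2 =
    (norm_h m xr M W)\<^sup>2 - (\<Sum>K\<in>elements M. \<Sum>j\<in>{1..dim_polys m}.
      weight M K j * ((A K j \<bullet> W K (node xr M K j))\<^sup>2 / (norm (A K j))\<^sup>2))"
proof -
  define N where "N = {1..dim_polys m}"
  define S where "S = tangent_space m xr M P"
  have fin: "finite (elements M)" using mesh by (simp add: mesh_on_def triangulation_def)
  have sym: "sym_matrix (U K x)" if "U \<in> Zh_sym m M" for U K x
    using that by (simp add: Zh_sym_def)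
  have S: "U \<in> S \<longleftrightarrow> U \<in> Zh_sym m M \<and> (\<forall>K\<in>elements M. \<forall>j\<in>N. A K j \<bullet> U K (node xr M K j) = 0)" for U
    unfolding S_def tangent_space_def N_def using cof sym by auto
  define t where "t K j = (A K j \<bullet> W K (node xr M K j)) / (norm (A K j))\<^sup>2" for K j
  obtain V where V: "V \<in> Zh_sym m M"
    and Vn: "\<And>K j. K \<in> elements M \<Longrightarrow> j \<in> N \<Longrightarrow> V K (node xr M K j) = W K (node xr M K j) - t K j *\<^sub>R A K j"
  proof -
    have "sym_matrix (W K (node xr M K j) - t K j *\<^sub>R A K j)" for K j
      using A(1)[of K j] sym[OF W, of K "node xr M K j"] by (simp add: sym_matrix_iff)
    from Zh_sym_nodal_exists[OF uni mesh, of "\<lambda>K j. W K (node xr M K j) - t K j *\<^sub>R A K j", OF this]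
    show thesis using that unfolding N_def by blast
  qed
  have tA: "t K j * (norm (A K j))\<^sup>2 = A K j \<bullet> W K (node xr M K j)" if "K \<in> elements M" "j \<in> N" for K j
    using A(2) that by (simp add: t_def N_def)
  have AV: "A K j \<bullet> V K (node xr M K j) = 0" if "K \<in> elements M" "j \<in> N" for K j
    using tA[OF that] by (simp add: Vn[OF that] inner_diff_right power2_norm_eq_inner)
  have VS: "V \<in> S" using V AV by (simp add: S)
  have orth: "inner_h m xr M (\<lambda>K x. W K x - V K x) U = 0" if U: "U \<in> S" for U
    unfolding inner_h_def
  proof (intro sum.neutral ballI)
    fix K j assume "K \<in> elements M" "j \<in> {1..dim_polys m}"
    then have "K \<in> elements M" "j \<in> N" by (simp_all add: N_def)
    then show "weight M K j * ((W K (node xr M K j) - V K (node xr M K j)) \<bullet> U K (node xr M K j)) = 0"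
      using U by (simp add: Vn S)
  qed
  have "orth_proj m xr M S W = V"
    unfolding orth_proj_def
  proof (rule the_equality)
    show "V \<in> S \<and> (\<forall>U\<in>S. inner_h m xr M (\<lambda>K x. W K x - V K x) U = 0)"
      using VS orth by blast
    fix V' assume V': "V' \<in> S \<and> (\<forall>U\<in>S. inner_h m xr M (\<lambda>K x. W K x - V' K x) U = 0)"
    let ?D = "\<lambda>K x. V K x - V' K x"
    have D: "?D \<in> S"
      using VS V' Zh_sym_diff by (auto simp: S inner_diff_right)
    have "inner_h m xr M (\<lambda>K x. W K x - V' K x) ?D - inner_h m xr M (\<lambda>K x. W K x - V K x) ?D = 0"
      using V' orth D by simp
    then have "inner_h m xr M ?D ?D = 0"
      by (simp add: inner_h_diff_left)
    then have "V K (node xr M K j) - V' K (node xr M K j) = 0" if "K \<in> elements M" "j \<in> {1..dim_polys m}" for K j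
      using inner_h_zero_imp[OF fin w, of xr ?D] that by blast
    then show "V' = V"
      using V V' by (intro Zh_sym_eqI[OF uni mesh]) (auto simp: S)
  qed
  moreover have "inner_h m xr M V V = inner_h m xr M W W - (\<Sum>K\<in>elements M. \<Sum>j\<in>N.
      weight M K j * ((A K j \<bullet> W K (node xr M K j))\<^sup>2 / (norm (A K j))\<^sup>2))"
    unfolding inner_h_def N_def[symmetric] sum_subtractf[symmetric]
  proof (intro sum.cong refl)
    fix K j assume Kj: "K \<in> elements M" "j \<in> N"
    define x where "x = node xr M K j"
    have "V K x \<bullet> V K x = V K x \<bullet> W K x"
      using AV[OF Kj] Vn[OF Kj] by (simp add: x_def inner_diff_right inner_commute)
    also have "\<dots> = W K x \<bullet> W K x - t K j * (A K j \<bullet> W K x)"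
      using Vn[OF Kj] by (simp add: x_def inner_diff_left)
    also have "t K j * (A K j \<bullet> W K x) = (A K j \<bullet> W K x)\<^sup>2 / (norm (A K j))\<^sup>2"
      by (simp add: t_def x_def power2_eq_square)
    finally show "weight M K j * (V K (node xr M K j) \<bullet> V K (node xr M K j)) =
        weight M K j * (W K (node xr M K j) \<bullet> W K (node xr M K j)) -
        weight M K j * ((A K j \<bullet> W K (node xr M K j))\<^sup>2 / (norm (A K j))\<^sup>2)"
      unfolding x_def[symmetric] by (simp only: right_diff_distrib)
  qed
  ultimately show ?thesis
    by (simp add: norm_h_square[OF w] S_def N_def)
qed

section \<open>The reconstruction\<close>

text \<open>The equation is solvable because a function without energy has a discrete Hessian that vanishes in
the discrete norm, so that the right-hand side annihilates it. The solution chosen by the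
reconstruction is then tested with itself.\<close>

lemma recon_energy:
  fixes X :: "'x::real_vector set"
  assumes X: "finite_dim_subspace X" and H: "discrete_hessian m M X H" and J: "sym_psd_form X J"
    and "0 < \<sigma>" and w: "weights_positive m M"
  obtains u where "u \<in> X" "recon m xr M X H J \<sigma> P = H u"
    "(norm_h m xr M (H u))\<^sup>2 + \<sigma> * J u u = inner_h m xr M P (H u)"
proof -
  let ?a = "recon_form m xr M H J \<sigma>"
  have Hadd: "H (v + v') = (\<lambda>K x. H v K x + H v' K x)" if "v \<in> X" "v' \<in> X" for v v'
    using H that by (simp add: discrete_hessian_def)
  have Hsc: "H (c *\<^sub>R v) = (\<lambda>K x. c *\<^sub>R H v K x)" if "v \<in> X" for c v
    using H that by (simp add: discrete_hessian_def)
  have Jp: "J v v' = J v' v" "J (u + v) v' = J u v' + J v v'" "J (c *\<^sub>R v) v' = c * J v v'" "0 \<le> J v v"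
    if "u \<in> X" "v \<in> X" "v' \<in> X" for u v v' c
    using J that by (simp_all add: sym_psd_form_def)
  have a0: "?a v v = inner_h m xr M (H v) (H v) + \<sigma> * J v v" for v
    by (simp add: recon_form_def)
  obtain u where u: "u \<in> X" "\<And>v. v \<in> X \<Longrightarrow> ?a u v = inner_h m xr M P (H v)"
  proof (rule riesz_semidefinite_finite_dim[OF X, of ?a "\<lambda>v. inner_h m xr M P (H v)"])
    show "?a v v' = ?a v' v" if "v \<in> X" "v' \<in> X" for v v'
      using that Jp(1) by (simp add: recon_form_def inner_h_commute[of m xr M "H v"])
    show "?a (u + v) v' = ?a u v' + ?a v v'" if "u \<in> X" "v \<in> X" "v' \<in> X" for u v v'
      using that by (simp add: recon_form_def Hadd inner_h_add_left Jp algebra_simps)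
    show "?a (c *\<^sub>R v) v' = c * ?a v v'" if "v \<in> X" "v' \<in> X" for c v v'
      using that by (simp add: recon_form_def Hsc inner_h_scale_left Jp algebra_simps)
    show "0 \<le> ?a v v" if "v \<in> X" for v
      unfolding a0 using Jp(4)[OF that that that] \<open>0 < \<sigma>\<close>
      by (intro add_nonneg_nonneg inner_h_nonneg[OF w] mult_nonneg_nonneg) auto
    show "inner_h m xr M P (H (v + v')) = inner_h m xr M P (H v) + inner_h m xr M P (H v')"
      if "v \<in> X" "v' \<in> X" for v v'
      using that by (simp add: inner_h_commute[of m xr M P] Hadd inner_h_add_left)
    show "inner_h m xr M P (H (c *\<^sub>R v)) = c * inner_h m xr M P (H v)" if "v \<in> X" for c v
      using that by (simp add: inner_h_commute[of m xr M P] Hsc inner_h_scale_left)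
    show "inner_h m xr M P (H v) = 0" if "v \<in> X" "?a v v = 0" for v
    proof -
      have "0 \<le> \<sigma> * J v v" using Jp(4) that(1) \<open>0 < \<sigma>\<close> by simp
      moreover have "0 \<le> inner_h m xr M (H v) (H v)" using w by (rule inner_h_nonneg)
      ultimately have "inner_h m xr M (H v) (H v) = 0" using that(2) unfolding a0 by linarith
      then show ?thesis using inner_h_Cauchy_Schwarz[OF w, of xr P "H v"] by simp
    qed
  qed blast
  define r where "r = recon_solution m xr M X H J \<sigma> P"
  have "r \<in> X \<and> (\<forall>v\<in>X. ?a r v = inner_h m xr M P (H v))"
    unfolding r_def recon_solution_def
    by (rule someI[of "\<lambda>r. r \<in> X \<and> (\<forall>v\<in>X. ?a r v = inner_h m xr M P (H v))" u]) (use u in blast)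
  then show thesis
    by (intro that[of r]) (auto simp: recon_def r_def norm_h_square[OF w] a0[symmetric])
qed

lemma recon_bounds:
  fixes X :: "'x::real_vector set"
  assumes X: "finite_dim_subspace X" and H: "discrete_hessian m M X H" and J: "sym_psd_form X J"
    and "0 < \<sigma>" and w: "weights_positive m M" and P: "norm_h m xr M P \<le> 1"
  obtains u where "u \<in> X" "recon m xr M X H J \<sigma> P = H u"
    "norm_h m xr M (H u) \<le> 1"
    "(norm_h m xr M (H u))\<^sup>2 + \<sigma> * J u u \<le> norm_h m xr M (H u)"
proof -
  obtain u where u: "u \<in> X" "recon m xr M X H J \<sigma> P = H u"
    "(norm_h m xr M (H u))\<^sup>2 + \<sigma> * J u u = inner_h m xr M P (H u)"
    using recon_energy[OF X H J \<open>0 < \<sigma>\<close> w] by metis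
  define a where "a = norm_h m xr M (H u)"
  have a0: "0 \<le> a" unfolding a_def using w by (rule norm_h_nonneg)
  have "(inner_h m xr M P (H u))\<^sup>2 \<le> (norm_h m xr M P * a)\<^sup>2"
    using inner_h_Cauchy_Schwarz[OF w, of xr P "H u"]
    by (simp add: a_def power_mult_distrib norm_h_square[OF w])
  then have "inner_h m xr M P (H u) \<le> norm_h m xr M P * a"
    by (rule power2_le_imp_le) (simp add: a0 norm_h_nonneg[OF w])
  also have "\<dots> \<le> a" using P a0 by (simp add: mult_left_le_one_le norm_h_nonneg[OF w])
  finally have le: "a\<^sup>2 + \<sigma> * J u u \<le> a" using u(3) by (simp add: a_def)
  moreover have "0 \<le> \<sigma> * J u u" using J u(1) \<open>0 < \<sigma>\<close> by (simp add: sym_psd_form_def)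
  ultimately have "a\<^sup>2 \<le> a" by linarith
  then have "a \<le> 1" using a0 by (cases "a = 0") (auto simp: power2_eq_square)
  then show thesis using that[OF u(1,2)] le unfolding a_def by blast
qed

section \<open>Coercivity of discrete Hessians along the cofactor matrix\<close>

lemma linear_sym_cof: "linear sym_cof"
proof (rule linearI)
  show "sym_cof (P + Q) = sym_cof P + sym_cof Q" for P Q
    by (simp add: vec_eq_iff forall_2 sym_cof_entries field_simps)
  show "sym_cof (c *\<^sub>R P) = c *\<^sub>R sym_cof P" for c P
    by (simp add: vec_eq_iff forall_2 sym_cof_entries algebra_simps)
qed

text \<open>Nodes may lie on the boundary, so the bounds assumed in the open domain are extended by continuity.\<close>

lemma elliptic_between_closure:
  assumes "continuous_on (closure S) G" "\<And>x. x \<in> S \<Longrightarrow> elliptic_between \<nu>2 \<nu>1 (G x)" "x \<in> closure S"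
  shows "elliptic_between \<nu>2 \<nu>1 (G x)"
  unfolding elliptic_between_def
proof (intro allI conjI)
  fix \<xi> :: "real^2"
  have c: "continuous_on (closure S) (\<lambda>x. \<xi> \<bullet> (G x *v \<xi>))"
    unfolding inner_vec_def matrix_vector_mult_def
    by (simp add: sum_2) (intro continuous_intros assms(1))
  show "\<nu>2 * (norm \<xi>)\<^sup>2 \<le> \<xi> \<bullet> (G x *v \<xi>)"
    using continuous_ge_on_closure[OF c assms(3)] assms(2) unfolding elliptic_between_def by blast
  show "\<xi> \<bullet> (G x *v \<xi>) \<le> \<nu>1 * (norm \<xi>)\<^sup>2"
    using continuous_le_on_closure[OF c assms(3)] assms(2) unfolding elliptic_between_def by blast
qed

lemma mesh_on_node_dist:
  assumes "mesh_on \<Omega> M" "K \<in> elements M" "s \<in> ref_triangle" "t \<in> ref_triangle"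
  shows "ref_map M K s \<in> closure \<Omega>" "dist (ref_map M K s) (ref_map M K t) \<le> mesh_size M"
proof -
  have K: "ref_map M K ` ref_triangle = K" and sub: "K \<subseteq> closure \<Omega>" and s: "2 simplex K"
    and fin: "finite (elements M)"
    using assms(1,2) unfolding mesh_on_def triangulation_def by blast+
  then have in_K: "ref_map M K s \<in> K" "ref_map M K t \<in> K" using assms(3,4) by blast+
  with sub show "ref_map M K s \<in> closure \<Omega>" by blast
  have "dist (ref_map M K s) (ref_map M K t) \<le> diameter K"
    using in_K compact_simplex[OF s] by (intro diameter_bounded_bound compact_imp_bounded)
  also have "\<dots> \<le> mesh_size M"
    unfolding mesh_size_def using fin assms(2) by (intro Max_ge) auto
  finally show "dist (ref_map M K s) (ref_map M K t) \<le> mesh_size M" .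
qed

lemma L2_broken_square:
  "(L2_broken M V)\<^sup>2 = (\<Sum>K\<in>elements M. LINT x:K|lebesgue. (norm (V K x))\<^sup>2)"
  unfolding L2_broken_def by (intro real_sqrt_pow2 sum_nonneg set_integral_nonneg_real) simp

lemma frobenius_entries: "(norm V)\<^sup>2 = (\<Sum>a\<in>UNIV. \<Sum>b\<in>UNIV. (V $ a $ b)\<^sup>2)" for V :: "real^2^2"
  unfolding power2_norm_eq_inner by (simp add: inner_vec_def power2_eq_square)

lemma norm_h_le_L2_broken:
  assumes w: "weights_positive m M" and mesh: "mesh_on \<Omega> M" and V: "V \<in> Zh_sym m M"
    and equiv: "\<And>K p. K \<in> elements M \<Longrightarrow> p \<in> polys m \<Longrightarrow>
      (\<Sum>j\<in>{1..dim_polys m}. weight M K j * (p (node xr M K j))\<^sup>2) \<le> C * (LINT x:K|lebesgue. (p x)\<^sup>2)"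
  shows "(norm_h m xr M V)\<^sup>2 \<le> C * (L2_broken M V)\<^sup>2"
proof -
  have "(\<Sum>j\<in>{1..dim_polys m}. weight M K j * (norm (V K (node xr M K j)))\<^sup>2) \<le>
      C * (LINT x:K|lebesgue. (norm (V K x))\<^sup>2)" if K: "K \<in> elements M" for K
  proof -
    have p: "(\<lambda>x. V K x $ a $ b) \<in> polys m" for a b
      using V K by (auto simp: Zh_sym_def Zh_def)
    have cK: "compact K" using mesh K compact_simplex unfolding mesh_on_def by blast
    have "(\<Sum>j\<in>{1..dim_polys m}. weight M K j * (norm (V K (node xr M K j)))\<^sup>2) =
        (\<Sum>a\<in>UNIV. \<Sum>b\<in>UNIV. \<Sum>j\<in>{1..dim_polys m}. weight M K j * (V K (node xr M K j) $ a $ b)\<^sup>2)"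
      by (simp add: frobenius_entries sum_2 sum.distrib algebra_simps)
    also have "\<dots> \<le> (\<Sum>a\<in>UNIV. \<Sum>b\<in>UNIV. C * (LINT x:K|lebesgue. (V K x $ a $ b)\<^sup>2))"
      by (intro sum_mono equiv[OF K p])
    also have "\<dots> = C * (LINT x:K|lebesgue. (norm (V K x))\<^sup>2)"
      by (simp add: frobenius_entries set_integral_sum_continuous[OF cK] continuous_intros
          continuous_on_polys[OF p] sum_distrib_left)
    finally show ?thesis .
  qed
  then show ?thesis
    unfolding norm_h_square[OF w] inner_h_def L2_broken_square sum_distrib_left power2_norm_eq_inner[symmetric]
    by (rule sum_mono)
qed

text \<open>Bookkeeping for the Cordes argument, with \<open>N = \<parallel>W\<parallel>\<close> and \<open>T = \<parallel>tr W\<parallel>\<close>: the factor \<open>1 - \<epsilon>/2\<close> leaves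
room to split the square of \<open>T + C2 \<surd>J\<close> with parameter \<open>\<epsilon>/4\<close>, since
\<open>(1 + \<epsilon>/4)(1 - \<epsilon>/2) \<le> 1 - \<epsilon>/4\<close>.\<close>

lemma trace_control_absorb:
  fixes N T D n :: real
  assumes "0 < \<epsilon>" "\<epsilon> \<le> 4" "0 \<le> N" "0 \<le> J" "0 \<le> C2"
    and tc: "N \<le> T + C2 * sqrt J"
    and cordes: "T\<^sup>2 \<le> D + (1 - \<epsilon> / 2) * N\<^sup>2" and "0 \<le> D"
  shows "\<epsilon> / 4 * N\<^sup>2 \<le> 2 * D + (1 + 4 / \<epsilon>) * C2\<^sup>2 * J"
proof -
  have "N\<^sup>2 \<le> (C2 * sqrt J + T)\<^sup>2" using tc assms(3) by (intro power_mono) auto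
  also have "\<dots> \<le> (1 + 4 / \<epsilon>) * (C2 * sqrt J)\<^sup>2 + (1 + \<epsilon> / 4) * T\<^sup>2"
    using young_square[of "\<epsilon> / 4" "C2 * sqrt J" T] assms(1) by simp
  also have "(C2 * sqrt J)\<^sup>2 = C2\<^sup>2 * J" using assms(4) by (simp add: power_mult_distrib)
  finally have 1: "N\<^sup>2 \<le> (1 + 4 / \<epsilon>) * C2\<^sup>2 * J + (1 + \<epsilon> / 4) * T\<^sup>2" by (simp add: mult.assoc)
  have "(1 + \<epsilon> / 4) * T\<^sup>2 \<le> (1 + \<epsilon> / 4) * D + ((1 + \<epsilon> / 4) * (1 - \<epsilon> / 2)) * N\<^sup>2"
    using mult_left_mono[OF cordes, of "1 + \<epsilon> / 4"] assms(1) by (simp only: distrib_left mult.assoc)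
  also have "(1 + \<epsilon> / 4) * D \<le> 2 * D" using assms(2,8) by (intro mult_right_mono) auto
  also have "((1 + \<epsilon> / 4) * (1 - \<epsilon> / 2)) * N\<^sup>2 \<le> (1 - \<epsilon> / 4) * N\<^sup>2"
    using assms(1) by (intro mult_right_mono) (auto simp: algebra_simps)
  finally have "(1 + \<epsilon> / 4) * T\<^sup>2 \<le> 2 * D + (1 - \<epsilon> / 4) * N\<^sup>2" by simp
  moreover have "(1 - \<epsilon> / 4) * N\<^sup>2 = N\<^sup>2 - \<epsilon> / 4 * N\<^sup>2" by (simp add: left_diff_distrib)
  ultimately show ?thesis using 1 by linarith
qed

text \<open>On each triangle the coefficient is frozen at \<open>z\<close>, the image of the origin. The frozen
\<open>B : V\<close> is a polynomial, so its integral is bounded by its nodal values, where \<open>B\<close> is replaced by the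
true coefficient; the difference is at most \<open>\<omega>\<close>.\<close>

lemma broken_trace_estimate:
  fixes G :: "real^2 \<Rightarrow> real^2^2"
  assumes mesh: "mesh_on \<Omega> M" and uni: "unisolvent_nodes m xr" and w: "weights_positive m M"
    and V: "V \<in> Zh_sym m M" and \<nu>: "0 < \<nu>2" and "0 \<le> C"
    and ell: "\<And>x. x \<in> closure \<Omega> \<Longrightarrow> elliptic_between \<nu>2 \<nu>1 (G x)"
    and osc: "\<And>x y. x \<in> closure \<Omega> \<Longrightarrow> y \<in> closure \<Omega> \<Longrightarrow> dist x y \<le> mesh_size M \<Longrightarrow>
      norm (sym_cof (G x) - sym_cof (G y)) \<le> \<omega>"
    and equiv: "\<And>K p. K \<in> elements M \<Longrightarrow> p \<in> polys m \<Longrightarrow>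
      (LINT x:K|lebesgue. (p x)\<^sup>2) \<le> C * (\<Sum>j\<in>{1..dim_polys m}. weight M K j * (p (node xr M K j))\<^sup>2)"
  defines "\<epsilon> \<equiv> \<nu>2\<^sup>2 / (2 * \<nu>1\<^sup>2)"
  shows "(L2_broken M (\<lambda>K x. trace (V K x)))\<^sup>2 \<le>
    (1 + 2 / \<epsilon>) / \<nu>2\<^sup>2 * C * (2 * (\<Sum>K\<in>elements M. \<Sum>j\<in>{1..dim_polys m}.
        weight M K j * (sym_cof (G (node xr M K j)) \<bullet> V K (node xr M K j))\<^sup>2)
      + 2 * \<omega>\<^sup>2 * (norm_h m xr M V)\<^sup>2) + (1 - \<epsilon> / 2) * (L2_broken M V)\<^sup>2"
proof -
  define N where "N = {1..dim_polys m}"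
  define Ce where "Ce = (1 + 2 / \<epsilon>) / \<nu>2\<^sup>2"
  have Ce: "0 \<le> Ce" unfolding Ce_def \<epsilon>_def by simp
  define d where "d K j = sym_cof (G (node xr M K j)) \<bullet> V K (node xr M K j)" for K j
  have "(LINT x:K|lebesgue. (trace (V K x))\<^sup>2) \<le>
      Ce * C * (2 * (\<Sum>j\<in>N. weight M K j * (d K j)\<^sup>2) +
        2 * \<omega>\<^sup>2 * (\<Sum>j\<in>N. weight M K j * (norm (V K (node xr M K j)))\<^sup>2)) +
      (1 - \<epsilon> / 2) * (LINT x:K|lebesgue. (norm (V K x))\<^sup>2)"
    if K: "K \<in> elements M" for K
  proof -
    have cK: "compact K" using mesh K compact_simplex unfolding mesh_on_def by blast
    have "0 \<in> ref_triangle" unfolding ref_triangle_def by (simp add: hull_inc)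
    note near = mesh_on_node_dist[OF mesh K _ this] mesh_on_node_dist(1)[OF mesh K this this]
    define z where "z = ref_map M K 0"
    have z: "z \<in> closure \<Omega>" unfolding z_def by (rule near(3))
    define B where "B = sym_cof (G z)"
    have p: "(\<lambda>x. V K x $ a $ b) \<in> polys m" for a b
      using V K by (auto simp: Zh_sym_def Zh_def)
    have cV: "continuous_on K (\<lambda>x. V K x $ a $ b)" for a b
      using p by (rule continuous_on_polys)
    have cn: "continuous_on K (\<lambda>x. (norm (V K x))\<^sup>2)"
      unfolding frobenius_entries by (intro continuous_intros cV)
    have ct: "continuous_on K (\<lambda>x. (trace (V K x))\<^sup>2)"
      unfolding trace_def by (intro continuous_intros cV)
    have pB: "(\<lambda>x. B \<bullet> V K x) \<in> polys m" using V K by (rule Zh_sym_inner_polys)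
    have cB: "continuous_on K (\<lambda>x. (B \<bullet> V K x)\<^sup>2)"
      by (intro continuous_intros continuous_on_polys[OF pB])
    have "(LINT x:K|lebesgue. (trace (V K x))\<^sup>2) \<le>
        (LINT x:K|lebesgue. Ce * (B \<bullet> V K x)\<^sup>2 + (1 - \<epsilon> / 2) * (norm (V K x))\<^sup>2)"
      unfolding Ce_def \<epsilon>_def B_def
      by (intro set_integral_mono_continuous[OF cK ct] cordes_inequality[OF ell[OF z] \<nu>]
          continuous_on_add continuous_on_mult_left cn cB[unfolded B_def])
    also have "\<dots> = Ce * (LINT x:K|lebesgue. (B \<bullet> V K x)\<^sup>2) + (1 - \<epsilon> / 2) * (LINT x:K|lebesgue. (norm (V K x))\<^sup>2)"
      by (simp add: set_integral_add_continuous[OF cK] continuous_on_mult_left cn cB)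
    also have "(LINT x:K|lebesgue. (B \<bullet> V K x)\<^sup>2) \<le> C * (\<Sum>j\<in>N. weight M K j * (B \<bullet> V K (node xr M K j))\<^sup>2)"
      unfolding N_def using K pB by (rule equiv)
    also have "(\<Sum>j\<in>N. weight M K j * (B \<bullet> V K (node xr M K j))\<^sup>2) \<le>
        (\<Sum>j\<in>N. weight M K j * (2 * (d K j)\<^sup>2 + 2 * \<omega>\<^sup>2 * (norm (V K (node xr M K j)))\<^sup>2))"
    proof (intro sum_mono mult_left_mono)
      fix j assume j: "j \<in> N"
      define y where "y = node xr M K j"
      have "xr j \<in> ref_triangle" using uni j by (auto simp: unisolvent_nodes_def N_def)
      then have y: "y \<in> closure \<Omega>" "dist y z \<le> mesh_size M"
        unfolding y_def z_def node_def by (rule near)+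
      have "norm (B - sym_cof (G y)) \<le> \<omega>"
        unfolding B_def using osc[OF z y(1)] y(2) by (simp add: dist_commute)
      then have "\<bar>(B - sym_cof (G y)) \<bullet> V K y\<bar> \<le> \<omega> * norm (V K y)"
        by (meson Cauchy_Schwarz_ineq2 mult_right_mono norm_ge_zero order_trans)
      then have "\<bar>(B - sym_cof (G y)) \<bullet> V K y\<bar>\<^sup>2 \<le> (\<omega> * norm (V K y))\<^sup>2"
        by (rule power_mono) simp
      then have "((B - sym_cof (G y)) \<bullet> V K y)\<^sup>2 \<le> \<omega>\<^sup>2 * (norm (V K y))\<^sup>2"
        by (simp add: power_mult_distrib)
      moreover have "B \<bullet> V K y = d K j + (B - sym_cof (G y)) \<bullet> V K y"
        by (simp add: d_def y_def inner_diff_left)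
      then have "(B \<bullet> V K y)\<^sup>2 \<le> 2 * (d K j)\<^sup>2 + 2 * ((B - sym_cof (G y)) \<bullet> V K y)\<^sup>2"
        using young_square[of 1 "d K j" "(B - sym_cof (G y)) \<bullet> V K y"] by simp
      ultimately show "(B \<bullet> V K (node xr M K j))\<^sup>2 \<le>
          2 * (d K j)\<^sup>2 + 2 * \<omega>\<^sup>2 * (norm (V K (node xr M K j)))\<^sup>2"
        unfolding y_def by linarith
      show "0 \<le> weight M K j" using w K j unfolding weights_positive_def N_def by (auto intro: less_imp_le)
    qed
    also have "\<dots> = 2 * (\<Sum>j\<in>N. weight M K j * (d K j)\<^sup>2) +
        2 * \<omega>\<^sup>2 * (\<Sum>j\<in>N. weight M K j * (norm (V K (node xr M K j)))\<^sup>2)"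
      by (simp add: sum.distrib sum_distrib_left algebra_simps)
    finally show ?thesis using Ce \<open>0 \<le> C\<close> by (simp add: mult_left_mono mult.assoc)
  qed
  from sum_mono[OF this]
  have "(\<Sum>K\<in>elements M. LINT x:K|lebesgue. (trace (V K x))\<^sup>2) \<le>
      Ce * C * (2 * (\<Sum>K\<in>elements M. \<Sum>j\<in>N. weight M K j * (d K j)\<^sup>2) +
        2 * \<omega>\<^sup>2 * (\<Sum>K\<in>elements M. \<Sum>j\<in>N. weight M K j * (norm (V K (node xr M K j)))\<^sup>2)) +
      (1 - \<epsilon> / 2) * (\<Sum>K\<in>elements M. LINT x:K|lebesgue. (norm (V K x))\<^sup>2)"
    by (simp only: sum.distrib flip: sum_distrib_left)
  then show ?thesis
    by (simp add: L2_broken_square norm_h_square[OF w] inner_h_def d_def Ce_def N_def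
        flip: power2_norm_eq_inner)
qed

text \<open>The oscillation \<open>\<omega>\<close> enters through \<open>2 \<omega>\<^sup>2 \<parallel>W\<parallel>\<^sub>h\<^sup>2\<close>, which is at most a constant times \<open>\<omega>\<^sup>2\<close> times the
square of the \<open>L\<^sup>2\<close> norm. It can be absorbed together with the Cordes term as soon as \<open>\<omega>\<close> is below a
threshold depending only on the ellipticity and the norm equivalence, and the mesh size is restricted
accordingly.\<close>

lemma hessian_coercive:
  fixes X :: "'i \<Rightarrow> 'x::real_vector set" and H :: "'i \<Rightarrow> 'x \<Rightarrow> (real^2^2) broken"
    and J :: "'i \<Rightarrow> 'x \<Rightarrow> 'x \<Rightarrow> real"
  assumes uni: "unisolvent_nodes m xr" and mesh: "\<And>i. i \<in> I \<Longrightarrow> mesh_on \<Omega> (M i)"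
    and sr: "shape_regular I M" and w: "weights_ok m I M"
    and H: "\<And>i. i \<in> I \<Longrightarrow> discrete_hessian m (M i) (X i) (H i)"
    and J: "\<And>i. i \<in> I \<Longrightarrow> sym_psd_form (X i) (J i)"
    and tc: "trace_control I M X H J"
    and cpt: "compact (closure \<Omega>)" and G: "continuous_on (closure \<Omega>) G"
    and \<nu>: "0 < \<nu>2" "\<nu>2 \<le> \<nu>1"
    and ell: "\<And>x. x \<in> closure \<Omega> \<Longrightarrow> elliptic_between \<nu>2 \<nu>1 (G x)"
  obtains h0 C where "0 < h0" "0 < C"
    "\<And>i v. i \<in> I \<Longrightarrow> mesh_size (M i) \<le> h0 \<Longrightarrow> v \<in> X i \<Longrightarrow>
      (norm_h m xr (M i) (H i v))\<^sup>2 \<le> C * ((\<Sum>K\<in>elements (M i). \<Sum>j\<in>{1..dim_polys m}.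
        weight (M i) K j * ((sym_cof (G (node xr (M i) K j)) \<bullet> H i v K (node xr (M i) K j))\<^sup>2 /
          (norm (sym_cof (G (node xr (M i) K j))))\<^sup>2)) + J i v v)"
proof -
  obtain C1 where C1: "0 < C1"
    "\<And>i K p. i \<in> I \<Longrightarrow> K \<in> elements (M i) \<Longrightarrow> p \<in> polys m \<Longrightarrow>
      (\<Sum>j\<in>{1..dim_polys m}. weight (M i) K j * (p (node xr (M i) K j))\<^sup>2) \<le>
        C1 * (LINT x:K|lebesgue. (p x)\<^sup>2)"
    "\<And>i K p. i \<in> I \<Longrightarrow> K \<in> elements (M i) \<Longrightarrow> p \<in> polys m \<Longrightarrow>
      (LINT x:K|lebesgue. (p x)\<^sup>2) \<le>
        C1 * (\<Sum>j\<in>{1..dim_polys m}. weight (M i) K j * (p (node xr (M i) K j))\<^sup>2)"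
    by (rule uniform_nodal_equivalence[OF uni mesh sr w]) blast+
  obtain C2 where C2: "0 < C2" "\<And>i v. i \<in> I \<Longrightarrow> v \<in> X i \<Longrightarrow>
      L2_broken (M i) (H i v) \<le> L2_broken (M i) (\<lambda>K x. trace (H i v K x)) + C2 * sqrt (J i v v)"
    using tc unfolding trace_control_def by blast
  define \<epsilon> where "\<epsilon> = \<nu>2\<^sup>2 / (2 * \<nu>1\<^sup>2)"
  have \<nu>1: "0 < \<nu>1" using \<nu> by linarith
  have "\<nu>2\<^sup>2 \<le> \<nu>1\<^sup>2" using \<nu> by (intro power_mono) auto
  then have "\<nu>2\<^sup>2 \<le> 8 * \<nu>1\<^sup>2" using zero_le_power2[of \<nu>1] by linarith
  then have \<epsilon>: "0 < \<epsilon>" "\<epsilon> \<le> 4" using \<nu>(1) \<nu>1 by (auto simp: \<epsilon>_def field_simps)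
  define Ce where "Ce = (1 + 2 / \<epsilon>) / \<nu>2\<^sup>2"
  have Ce: "0 < Ce" using \<epsilon> \<nu> by (simp add: Ce_def add_pos_pos)
  \<comment> \<open>The threshold for which the oscillation costs half of the gain \<open>\<epsilon>/4\<close> that the Cordes term leaves.\<close>
  define \<omega> where "\<omega> = sqrt (\<epsilon> / (32 * Ce * C1\<^sup>2))"
  have \<omega>: "0 < \<omega>" "\<omega>\<^sup>2 = \<epsilon> / (32 * Ce * C1\<^sup>2)"
    using \<epsilon> Ce C1(1) by (simp_all add: \<omega>_def)
  have "continuous_on (closure \<Omega>) (\<lambda>x. sym_cof (G x))"
    using G linear_sym_cof by (rule linear_continuous_on_compose)
  then have "uniformly_continuous_on (closure \<Omega>) (\<lambda>x. sym_cof (G x))"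
    using cpt by (rule compact_uniformly_continuous)
  then obtain \<delta> where \<delta>: "0 < \<delta>" "\<And>x y. x \<in> closure \<Omega> \<Longrightarrow> y \<in> closure \<Omega> \<Longrightarrow> dist y x < \<delta> \<Longrightarrow>
      dist (sym_cof (G y)) (sym_cof (G x)) < \<omega>"
    using \<omega>(1) unfolding uniformly_continuous_on_def by metis
  define C3 where "C3 = 8 * \<nu>1\<^sup>2 * (2 * Ce * C1) * 2 + (1 + 4 / \<epsilon>) * C2\<^sup>2"
  define C where "C = 8 * C1 / \<epsilon> * C3"
  have C3: "0 < C3" using \<nu>1 Ce C1(1) \<epsilon> C2(1) by (simp add: C3_def add_pos_pos)
  show thesis
  proof (rule that[of "\<delta> / 2" C])
    show "0 < \<delta> / 2" using \<delta> by simp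
    show "0 < C" using C3 \<epsilon> C1(1) by (simp add: C_def)
    fix i v assume i: "i \<in> I" and h: "mesh_size (M i) \<le> \<delta> / 2" and v: "v \<in> X i"
    have wp: "weights_positive m (M i)" using w i mesh[OF i] by (rule weights_ok_positive)
    have V: "H i v \<in> Zh_sym m (M i)" using H[OF i] v by (simp add: discrete_hessian_def)
    have Jv: "0 \<le> J i v v" using J[OF i] v by (simp add: sym_psd_form_def)
    let ?A = "\<lambda>K j. sym_cof (G (node xr (M i) K j))"
    let ?V = "\<lambda>K j. H i v K (node xr (M i) K j)"
    define N where "N = L2_broken (M i) (H i v)"
    define n where "n = norm_h m xr (M i) (H i v)"
    define d where "d = (\<Sum>K\<in>elements (M i). \<Sum>j\<in>{1..dim_polys m}. weight (M i) K j * (?A K j \<bullet> ?V K j)\<^sup>2)"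
    define d' where "d' = (\<Sum>K\<in>elements (M i). \<Sum>j\<in>{1..dim_polys m}.
      weight (M i) K j * ((?A K j \<bullet> ?V K j)\<^sup>2 / (norm (?A K j))\<^sup>2))"
    have wnn: "0 \<le> weight (M i) K j" if "K \<in> elements (M i)" "j \<in> {1..dim_polys m}" for K j
      using wp that unfolding weights_positive_def by (auto intro: less_imp_le)
    have N0: "0 \<le> N" unfolding N_def L2_broken_def by (intro real_sqrt_ge_zero sum_nonneg set_integral_nonneg_real) simp
    have nN: "n\<^sup>2 \<le> C1 * N\<^sup>2"
      unfolding n_def N_def using wp mesh[OF i] V C1(2)[OF i] by (rule norm_h_le_L2_broken)
    have d0: "0 \<le> d" unfolding d_def by (intro sum_nonneg mult_nonneg_nonneg wnn) auto
    have dd': "d \<le> 4 * \<nu>1\<^sup>2 * d'"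
      unfolding d_def d'_def sum_distrib_left
    proof (intro sum_mono)
      fix K j assume K: "K \<in> elements (M i)" and j: "j \<in> {1..dim_polys m}"
      have "xr j \<in> ref_triangle" using uni j by (simp add: unisolvent_nodes_def)
      then have "node xr (M i) K j \<in> closure \<Omega>"
        unfolding node_def by (intro mesh_on_node_dist(1)[OF mesh[OF i] K])
      note b = elliptic_sym_cof_bounds[OF ell[OF this] \<nu>(1)]
      have "?A K j \<noteq> 0"
      proof
        assume z: "?A K j = 0"
        have "det (?A K j) = 0" unfolding z by (simp add: det_2)
        with b(2) \<nu>(1) show False by simp
      qed
      then have "(?A K j \<bullet> ?V K j)\<^sup>2 = (norm (?A K j))\<^sup>2 * ((?A K j \<bullet> ?V K j)\<^sup>2 / (norm (?A K j))\<^sup>2)"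
        by simp
      also have "\<dots> \<le> 4 * \<nu>1\<^sup>2 * ((?A K j \<bullet> ?V K j)\<^sup>2 / (norm (?A K j))\<^sup>2)"
        using b(3) by (rule mult_right_mono) simp
      finally have "weight (M i) K j * (?A K j \<bullet> ?V K j)\<^sup>2 \<le>
          weight (M i) K j * (4 * \<nu>1\<^sup>2 * ((?A K j \<bullet> ?V K j)\<^sup>2 / (norm (?A K j))\<^sup>2))"
        using wnn[OF K j] by (rule mult_left_mono)
      then show "weight (M i) K j * (?A K j \<bullet> ?V K j)\<^sup>2 \<le>
          4 * \<nu>1\<^sup>2 * (weight (M i) K j * ((?A K j \<bullet> ?V K j)\<^sup>2 / (norm (?A K j))\<^sup>2))"
        by (simp add: mult.left_commute)
    qed
    have osc: "norm (sym_cof (G x) - sym_cof (G y)) \<le> \<omega>"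
      if "x \<in> closure \<Omega>" "y \<in> closure \<Omega>" "dist x y \<le> mesh_size (M i)" for x y
      using \<delta>(2)[OF that(2,1)] that(3) h \<delta>(1) by (simp add: dist_norm)
    have T: "(L2_broken (M i) (\<lambda>K x. trace (H i v K x)))\<^sup>2 \<le>
        Ce * C1 * (2 * d + 2 * \<omega>\<^sup>2 * n\<^sup>2) + (1 - \<epsilon> / 2) * N\<^sup>2"
      unfolding Ce_def \<epsilon>_def d_def n_def N_def
      using mesh[OF i] uni wp V \<nu>(1) less_imp_le[OF C1(1)] ell osc C1(3)[OF i]
      by (rule broken_trace_estimate)
    have "\<epsilon> / 4 * N\<^sup>2 \<le> 2 * (Ce * C1 * (2 * d + 2 * \<omega>\<^sup>2 * n\<^sup>2)) + (1 + 4 / \<epsilon>) * C2\<^sup>2 * J i v v"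
    proof (rule trace_control_absorb[OF \<epsilon> N0 Jv less_imp_le[OF C2(1)] _ T])
      show "N \<le> L2_broken (M i) (\<lambda>K x. trace (H i v K x)) + C2 * sqrt (J i v v)"
        unfolding N_def using i v by (rule C2(2))
      show "0 \<le> Ce * C1 * (2 * d + 2 * \<omega>\<^sup>2 * n\<^sup>2)" using Ce C1(1) d0 by simp
    qed
    also have "Ce * C1 * (2 * d + 2 * \<omega>\<^sup>2 * n\<^sup>2) \<le> Ce * C1 * (2 * d + 2 * \<omega>\<^sup>2 * (C1 * N\<^sup>2))"
      using Ce C1(1) nN by (intro mult_left_mono add_left_mono) auto
    also have "\<dots> = 2 * Ce * C1 * d + (32 * Ce * C1\<^sup>2 * \<omega>\<^sup>2) / 16 * N\<^sup>2"
      by (simp add: power2_eq_square algebra_simps)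
    also have "32 * Ce * C1\<^sup>2 * \<omega>\<^sup>2 = \<epsilon>"
      using Ce C1(1) by (simp add: \<omega>(2))
    finally have "\<epsilon> / 8 * N\<^sup>2 \<le> 2 * (2 * Ce * C1) * d + (1 + 4 / \<epsilon>) * C2\<^sup>2 * J i v v"
      by simp
    also have "2 * (2 * Ce * C1) * d \<le> 2 * (2 * Ce * C1) * (4 * \<nu>1\<^sup>2 * d')"
      using Ce C1(1) dd' by (intro mult_left_mono) auto
    finally have *: "\<epsilon> / 8 * N\<^sup>2 \<le> 8 * \<nu>1\<^sup>2 * (2 * Ce * C1) * d' + (1 + 4 / \<epsilon>) * C2\<^sup>2 * J i v v"
      by (simp add: ac_simps)
    have d'0: "0 \<le> d'" unfolding d'_def by (intro sum_nonneg mult_nonneg_nonneg wnn) auto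
    have "8 * \<nu>1\<^sup>2 * (2 * Ce * C1) * d' \<le> C3 * d'"
      using d'0 Ce C1(1) \<epsilon> by (intro mult_right_mono) (auto simp: C3_def)
    moreover have "(1 + 4 / \<epsilon>) * C2\<^sup>2 * J i v v \<le> C3 * J i v v"
      using Jv Ce C1(1) \<epsilon> by (intro mult_right_mono) (auto simp: C3_def)
    ultimately have "\<epsilon> / 8 * N\<^sup>2 \<le> C3 * (d' + J i v v)"
      using * by (simp add: distrib_left)
    then have "8 * C1 / \<epsilon> * (\<epsilon> / 8 * N\<^sup>2) \<le> 8 * C1 / \<epsilon> * (C3 * (d' + J i v v))"
      using C1(1) \<epsilon> by (intro mult_left_mono) auto
    then have "C1 * N\<^sup>2 \<le> C * (d' + J i v v)"
      using \<epsilon> by (simp add: C_def mult.assoc)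
    with nN have "n\<^sup>2 \<le> C * (d' + J i v v)" by linarith
    then show "(norm_h m xr (M i) (H i v))\<^sup>2 \<le> C * ((\<Sum>K\<in>elements (M i). \<Sum>j\<in>{1..dim_polys m}.
        weight (M i) K j * ((?A K j \<bullet> ?V K j)\<^sup>2 / (norm (?A K j))\<^sup>2)) + J i v v)"
      unfolding n_def d'_def .
  qed
qed

section \<open>The contraction\<close>

text \<open>Here \<open>b\<close> is the norm after projection. If \<open>a\<close> is not close to \<open>1\<close>, then \<open>b \<le> a\<close> suffices; if it is,
then \<open>J\<close> is small and coercivity forces a loss \<open>a\<^sup>2 - b\<^sup>2\<close>. Chaining the two inequalities
as \<open>b\<^sup>2 \<le> a\<^sup>2 \<le> D (a - b\<^sup>2)\<close> treats both cases at once.\<close>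

lemma contraction_from_energy:
  fixes a b J C \<sigma> :: real
  assumes "0 \<le> a" "a \<le> 1" "a\<^sup>2 + \<sigma> * J \<le> a" "0 < \<sigma>" "0 < C"
    and "a\<^sup>2 \<le> C * ((a\<^sup>2 - b\<^sup>2) + J)" and "b\<^sup>2 \<le> a\<^sup>2"
  shows "b\<^sup>2 \<le> (C + C / \<sigma>) / (1 + (C + C / \<sigma>))"
proof -
  define D where "D = C + C / \<sigma>"
  have D: "0 < D" using assms(4,5) by (simp add: D_def add_pos_pos)
  have "J \<le> (a - a\<^sup>2) / \<sigma>" using assms(3,4) by (simp add: field_simps)
  then have "C * J \<le> C * ((a - a\<^sup>2) / \<sigma>)" using assms(5) by (intro mult_left_mono) auto
  then have "C * J \<le> C / \<sigma> * (a - a\<^sup>2)" by simp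
  moreover have "0 \<le> C / \<sigma> * (a\<^sup>2 - b\<^sup>2)" using assms by simp
  moreover have "0 \<le> C * (a - a\<^sup>2)"
  proof -
    have "a\<^sup>2 \<le> a" using assms(1,2) by (simp add: power2_eq_square mult_left_le)
    with assms(5) show ?thesis by simp
  qed
  ultimately have "a\<^sup>2 \<le> D * (a - b\<^sup>2)"
    using assms(6) unfolding D_def by (simp add: algebra_simps)
  with assms(7) have "b\<^sup>2 \<le> D * (a - b\<^sup>2)" by linarith
  also have "\<dots> \<le> D * (1 - b\<^sup>2)" using D assms(2) by (intro mult_left_mono) auto
  finally have "b\<^sup>2 * (1 + D) \<le> D" by (simp add: algebra_simps)
  then show ?thesis using D unfolding D_def[symmetric] by (simp add: pos_le_divide_eq)
qed

theorem lemma4p3: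
  fixes \<Omega> :: "(real^2) set" and m :: nat and xr :: "nat \<Rightarrow> real^2"
    and I :: "'i set" and M :: "'i \<Rightarrow> mesh"
    and f g u :: "real^2 \<Rightarrow> real" and D2u :: "real^2 \<Rightarrow> real^2^2"
    and X :: "'i \<Rightarrow> 'x::real_vector set" and H :: "'i \<Rightarrow> 'x \<Rightarrow> (real^2^2) broken"
    and J :: "'i \<Rightarrow> 'x \<Rightarrow> 'x \<Rightarrow> real" and \<sigma> :: real
  assumes "polygonal_convex_domain \<Omega>"
    and "unisolvent_nodes m xr"
    and "\<And>i. i \<in> I \<Longrightarrow> mesh_on \<Omega> (M i)"
    and "shape_regular I M"
    and "quasi_uniform I M"
    and "weights_ok m I M"
    and "\<And>i. i \<in> I \<Longrightarrow> finite_dim_subspace (X i)"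
    and "\<And>i. i \<in> I \<Longrightarrow> discrete_hessian m (M i) (X i) (H i)"
    and "\<And>i. i \<in> I \<Longrightarrow> sym_psd_form (X i) (J i)"
    and "\<sigma> > 0"
    and A1: "exact_solution m \<Omega> f g u D2u"
    and A2: "trace_control I M X H J"
  shows "(\<forall>i\<in>I. opnorm_h m xr (M i) (recon m xr (M i) (X i) (H i) (J i) \<sigma>) \<le> 1) \<and>
    (\<exists>h0>0. \<exists>q0. 0 < q0 \<and> q0 < 1 \<and>
      (\<forall>i\<in>I. mesh_size (M i) \<le> h0 \<longrightarrow>
        opnorm_h m xr (M i)
          (orth_proj m xr (M i) (tangent_space m xr (M i) (interp_matrix m xr (M i) D2u))
             \<circ> recon m xr (M i) (X i) (H i) (J i) \<sigma>) \<le> ereal q0))"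
proof
  note uni = assms(2) and mesh = assms(3) and X = assms(7) and H = assms(8) and J = assms(9)
    and \<sigma> = assms(10)
  have wp: "weights_positive m (M i)" if "i \<in> I" for i
    using assms(6) that mesh[OF that] by (rule weights_ok_positive)
  show "\<forall>i\<in>I. opnorm_h m xr (M i) (recon m xr (M i) (X i) (H i) (J i) \<sigma>) \<le> 1"
  proof
    fix i assume i: "i \<in> I"
    show "opnorm_h m xr (M i) (recon m xr (M i) (X i) (H i) (J i) \<sigma>) \<le> 1"
      unfolding opnorm_h_def
    proof (rule SUP_least)
      fix V assume "V \<in> {V \<in> Zh_sym m (M i). norm_h m xr (M i) V \<le> 1}"
      then have "norm_h m xr (M i) V \<le> 1" by simp
      then obtain v where "recon m xr (M i) (X i) (H i) (J i) \<sigma> V = H i v" "norm_h m xr (M i) (H i v) \<le> 1"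
        using recon_bounds[OF X[OF i] H[OF i] J[OF i] \<sigma> wp[OF i]] by metis
      then show "ereal (norm_h m xr (M i) (recon m xr (M i) (X i) (H i) (J i) \<sigma> V)) \<le> 1"
        by simp
    qed
  qed
  have \<Omega>: "compact (closure \<Omega>)"
    using assms(1) polytope_imp_compact unfolding polygonal_convex_domain_def by blast
  have cont: "continuous_on (closure \<Omega>) D2u" using A1 by (simp add: exact_solution_def)
  obtain \<nu>1 \<nu>2 where \<nu>: "\<nu>2 \<le> \<nu>1" "0 < \<nu>2" "\<And>x. x \<in> \<Omega> \<Longrightarrow> elliptic_between \<nu>2 \<nu>1 (D2u x)"
    using A1 unfolding exact_solution_def elliptic_between_def by blast
  have ell: "elliptic_between \<nu>2 \<nu>1 (D2u x)" if "x \<in> closure \<Omega>" for x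
    using cont \<nu>(3) that by (rule elliptic_between_closure)
  obtain h0 C where h0: "0 < h0" and C: "0 < C"
    and coercive: "\<And>i v. i \<in> I \<Longrightarrow> mesh_size (M i) \<le> h0 \<Longrightarrow> v \<in> X i \<Longrightarrow>
      (norm_h m xr (M i) (H i v))\<^sup>2 \<le> C * ((\<Sum>K\<in>elements (M i). \<Sum>j\<in>{1..dim_polys m}.
        weight (M i) K j * ((sym_cof (D2u (node xr (M i) K j)) \<bullet> H i v K (node xr (M i) K j))\<^sup>2 /
          (norm (sym_cof (D2u (node xr (M i) K j))))\<^sup>2)) + J i v v)"
    by (rule hessian_coercive[OF uni mesh assms(4,6) H J A2 \<Omega> cont \<nu>(2,1) ell]) blast+
  define q where "q = (C + C / \<sigma>) / (1 + (C + C / \<sigma>))"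
  have "0 < C + C / \<sigma>" using C \<sigma> by (simp add: add_pos_pos)
  then have q: "0 < q" "q < 1" by (simp_all add: q_def)
  have "opnorm_h m xr (M i)
      (orth_proj m xr (M i) (tangent_space m xr (M i) (interp_matrix m xr (M i) D2u))
        \<circ> recon m xr (M i) (X i) (H i) (J i) \<sigma>) \<le> ereal (sqrt q)"
    if i: "i \<in> I" and h: "mesh_size (M i) \<le> h0" for i
    unfolding opnorm_h_def
  proof (rule SUP_least)
    let ?P = "orth_proj m xr (M i) (tangent_space m xr (M i) (interp_matrix m xr (M i) D2u))"
    fix V assume "V \<in> {V \<in> Zh_sym m (M i). norm_h m xr (M i) V \<le> 1}"
    then have "norm_h m xr (M i) V \<le> 1" by simp
    from recon_bounds[OF X[OF i] H[OF i] J[OF i] \<sigma> wp[OF i] this]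
    obtain v where v: "v \<in> X i" "recon m xr (M i) (X i) (H i) (J i) \<sigma> V = H i v"
      and a: "norm_h m xr (M i) (H i v) \<le> 1"
        "(norm_h m xr (M i) (H i v))\<^sup>2 + \<sigma> * J i v v \<le> norm_h m xr (M i) (H i v)" .
    let ?A = "\<lambda>K j. sym_cof (D2u (node xr (M i) K j))"
    let ?d = "\<Sum>K\<in>elements (M i). \<Sum>j\<in>{1..dim_polys m}.
        weight (M i) K j * ((?A K j \<bullet> H i v K (node xr (M i) K j))\<^sup>2 / (norm (?A K j))\<^sup>2)"
    have node: "node xr (M i) K j \<in> closure \<Omega>" if "K \<in> elements (M i)" "j \<in> {1..dim_polys m}" for K j
      unfolding node_def
      using uni that(2) by (intro mesh_on_node_dist(1)[OF mesh[OF i] that(1)]) (auto simp: unisolvent_nodes_def)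
    have proj: "(norm_h m xr (M i) (?P (H i v)))\<^sup>2 = (norm_h m xr (M i) (H i v))\<^sup>2 - ?d"
    proof (rule norm_orth_proj_tangent[OF uni mesh[OF i] wp[OF i]])
      show "H i v \<in> Zh_sym m (M i)" using H[OF i] v(1) by (simp add: discrete_hessian_def)
      show "sym_matrix (?A K j)" for K j by (rule sym_matrix_sym_cof)
      fix K j assume Kj: "K \<in> elements (M i)" "j \<in> {1..dim_polys m}"
      note b = elliptic_sym_cof_bounds[OF ell[OF node[OF Kj]] \<nu>(2)]
      show "?A K j \<noteq> 0"
      proof
        assume z: "?A K j = 0"
        have "det (?A K j) = 0" unfolding z by (simp add: det_2)
        with b(2) \<nu>(2) show False by simp
      qed
      show "cof (interp_matrix m xr (M i) D2u K (node xr (M i) K j)) \<bullet> U = ?A K j \<bullet> U"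
        if "sym_matrix U" for U
        unfolding interp_matrix_node[OF uni mesh[OF i] Kj]
        using b(1) that by (intro cof_inner_sym) auto
    qed
    have d0: "0 \<le> ?d"
      using wp[OF i] unfolding weights_positive_def
      by (intro sum_nonneg mult_nonneg_nonneg) (auto intro: less_imp_le)
    have "(norm_h m xr (M i) (?P (H i v)))\<^sup>2 \<le> q"
      unfolding q_def
    proof (rule contraction_from_energy[OF norm_h_nonneg[OF wp[OF i]] a \<sigma> C])
      show "(norm_h m xr (M i) (H i v))\<^sup>2 \<le>
          C * ((norm_h m xr (M i) (H i v))\<^sup>2 - (norm_h m xr (M i) (?P (H i v)))\<^sup>2 + J i v v)"
        using coercive[OF i h v(1)] unfolding proj by simp
      show "(norm_h m xr (M i) (?P (H i v)))\<^sup>2 \<le> (norm_h m xr (M i) (H i v))\<^sup>2"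
        using proj d0 by linarith
    qed
    then have "norm_h m xr (M i) (?P (H i v)) \<le> sqrt q" by (rule real_le_rsqrt)
    then show "ereal (norm_h m xr (M i) ((?P \<circ> recon m xr (M i) (X i) (H i) (J i) \<sigma>) V)) \<le> ereal (sqrt q)"
      by (simp add: v(2))
  qed
  moreover have "0 < sqrt q" "sqrt q < 1" using q by simp_all
  ultimately show "\<exists>h0>0. \<exists>q0. 0 < q0 \<and> q0 < 1 \<and>
      (\<forall>i\<in>I. mesh_size (M i) \<le> h0 \<longrightarrow>
        opnorm_h m xr (M i)
          (orth_proj m xr (M i) (tangent_space m xr (M i) (interp_matrix m xr (M i) D2u))
             \<circ> recon m xr (M i) (X i) (H i) (J i) \<sigma>) \<le> ereal q0)"
    using h0 by blast
qed

end
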